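(* Let $F$ be constant in time with value in $\mathcal H^*$, $G\in W^{1,1}(I;\mathcal S)$, $u_0\in\mathcal U$, $\varSigma_0=\mathfrak C Eu_0+G(0)\in\mathcal S$, $v_0\in\mathcal H$, $z_0\in\mathcal Z$. Assume that there are $\epsilon>0$, $p\ge 2$, $C_0\in\mathbb R$ and $\ell\in\mathbb R$ such that, for all $\varSigma\in\mathcal S$, $v\in\mathcal H$ and $z,\tilde z\in\mathcal Z$, $$\mathcal T(v)\ge\epsilon\|v\|_{\mathcal H}^2,\qquad \varPhi(\varSigma,z)\ge\epsilon\|\varSigma\|_{\mathcal S}^2+\epsilon\|z\|_{\mathcal Z}^2,\qquad \varPsi(z)\ge\epsilon\|z\|_{\mathcal Z_1}^p,$$ $$\|\varPhi'_\varSigma(\varSigma,z)\|_{\mathcal S^*}\le C_0\big(1+\|\varSigma\|_{\mathcal S}+\|z\|_{\mathcal Z}\big),\qquad \|\varPhi'_\varSigma(\varSigma,z)-\varPhi'_\varSigma(\varSigma,\tilde z)\|_{\mathcal S^*}\le\ell\,\|z-\tilde z\|_{\mathcal Z_1}.$$ Assume the following CFL condition: there is $\eta\in(0,4)$, independent of the considered $\tau$ and $h$, such that for all $\varSigma_h\in\mathcal S_h$ and all $z_h,\tilde z_h\in\mathcal Z_h$, $$\varPhi(\varSigma_h,z_h)\ \ge\ \frac{\tau^2}{4-\eta}\,\big\langle E_h^*S_h,(\mathcal T')^{-1}E_h^*S_h\big\rangle_{\mathcal H^*\times\mathcal H}\qquad\text{with } S_h=\mathfrak C^*\varPhi'_\varSigma(\varSigma_h,\tilde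 z_h).$$ Then, for $\tau>0$ sufficiently small, the interpolants $u_{\tau h},\varSigma_{\tau h},v_{\tau h},z_{\tau h}$ of the solution of the three-step staggered scheme satisfy, with a constant $C$ independent of $\tau$ and $h$, $$\|u_{\tau h}\|_{W^{1,\infty}(I;\mathcal H)}\le C,$$ $$\|\varSigma_{\tau h}\|_{L^\infty(I;\mathcal S)}\le C,\qquad \|\dot\varSigma_{\tau h}\|_{L^1(I;\mathcal X^* )}\le C,$$ $$\|v_{\tau h}\|_{L^\infty(I;\mathcal H)}\le C,\qquad \|\mathcal T'\dot v_{\tau h}\|_{L^\infty(I;\mathcal U^* )}\le C,$$ $$\|z_{\tau h}\|_{L^\infty(I;\mathcal Z)}\le C,\qquad \|\dot z_{\tau h}\|_{L^p(I;\mathcal Z_1)}\le C.$$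
   Context: **Spaces and functionals.** $I=[0,T]$ with $T>0$. $\mathcal S,\mathcal E,\mathcal Z,\mathcal Z_1$ are Banach spaces with $\mathcal Z\subset\mathcal Z_1$, and $\mathcal H$ is a Hilbert space identified with its dual $\mathcal H^*$. $E$ is an (abstract gradient-type) linear operator, and $\mathcal U:=\{u\in\mathcal H;\ Eu\in\mathcal E\}$ is a Banach space with the graph norm, so $E:\mathcal U\to\mathcal E$ is linear and continuous; $\mathcal U$ is densely embedded in $\mathcal H$, so $\mathcal U\subset\mathcal H\cong\mathcal H^*\subset\mathcal U^*$. $\mathfrak C:\mathcal E\to\mathcal S$ is linear, continuous and invertible. $^*$ on operators denotes the adjoint, so $E^*:\mathcal E^*\to\mathcal U^*$ and $\mathfrak C^*:\mathcal S^*\to\mathcal E^*$. $\mathcal X:=\{X\in\mathcal S^*;\ E^*\mathfrak C^*X\in\mathcal H^*\}$ with its graph norm; elements of $\mathcal S$ act on $\mathcal X\subset\mathcal S^*$, hence are regarded as elements of $\mathcal X^*$. $\mathcal T:\mathcal H\to\mathbb R$ (kinetic energy) is quadratic, with (linear) derivative $\mathcal T':\mathcal H\to\mathcal H^*$, $\mathcal T(v)=\frac12\langle\mathcal T'v,v\rangle$. $\varPhi:\mathcal S\times\mathcal Z\to\mathbb R$ (stored energy) is smooth, and $\varPhi(\cdot,z)$ and $\varPhi(\varSigma,\cdot)$ are quadratic; $\varPhi'_\varSigma$, $\varPhi'_z$ are its partial Gâteaux derivatives. $\varPsi:\mathcal Z\to[0,+\infty]$ (dissipation potential) is convex and lower semicontinuous,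 with convex subdifferential $\partial\varPsi$. A dot denotes the time derivative. **Discretisation.** $\tau>0$ is a time step with $T/\tau$ an integer and $h>0$ is a spatial discretisation parameter. $V_h\subset\mathcal H$, $\mathcal S_h\subset\mathcal S$, $\mathcal Z_h\subset\mathcal Z$ are finite-dimensional subspaces. $E_h\in\mathrm{Lin}(\mathcal H,\mathcal E)$ (space of bounded linear operators) are approximations of $E$, bounded uniformly in $h$, i.e. $\sup_h\|E_h\|_{\mathrm{Lin}(\mathcal H,\mathcal E)}<\infty$, with $\mathfrak CE_h(V_h)\subset\mathcal S_h$; $E_h^*:\mathcal E^*\to\mathcal H^*$ is the adjoint. $F_h\in\mathcal H^*$ (constant in time) and $G_h\in W^{1,1}(I;\mathcal S)$, valued in $\mathcal S_h$, are approximations of $F$ and $G$, with $F_h\to F$ in $\mathcal H^*$ and $G_h\to G$ in $W^{1,1}(I;\mathcal S)$ as $h\to0$, bounded uniformly in $h$. Put $$F_{\tau h}^{k+1}:=F_h,\qquad D_{\tau h}^k:=\frac{G_h((k+\frac12)\tau)-G_h((k-\frac12)\tau)}{\tau},$$ with $G_h(t):=G_h(0)$ for $t<0$. **Three-step staggered scheme.** Starting from $u_{\tau h}^0\in V_h$, $\varSigma_{\tau h}^0\in\mathcal S_h$, $v_{\tau h}^0\in V_h$, $z_{\tau h}^0\in\mathcal Z_h$ (approximations of $u_0,\varSigma_0,v_0,z_0$, uniformly bounded and converging in $\mathcal H,\mathcal S,\mathcal H,\mathcal Z$, respectively, as $h\to 0$), for $k=0,1,\dots,T/\tau-1$ one finds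 successively: 1. $\varSigma_{\tau h}^{k+1}\in\mathcal S_h$ with $\dfrac{\varSigma_{\tau h}^{k+1}-\varSigma_{\tau h}^k}{\tau}=\mathfrak CE_hv_{\tau h}^k+D_{\tau h}^k$; 2. $z_{\tau h}^{k+1}\in\mathcal Z_h$ with $\partial\varPsi\Big(\dfrac{z_{\tau h}^{k+1}-z_{\tau h}^k}{\tau}\Big)+\varPhi'_z\Big(\varSigma_{\tau h}^{k+1},\dfrac{z_{\tau h}^{k+1}+z_{\tau h}^k}{2}\Big)\ni0$, meaning $$\varPsi(\tilde z)+\Big\langle\varPhi'_z\Big(\varSigma_{\tau h}^{k+1},\frac{z_{\tau h}^{k+1}+z_{\tau h}^k}{2}\Big),\tilde z-\frac{z_{\tau h}^{k+1}-z_{\tau h}^k}{\tau}\Big\rangle\ge\varPsi\Big(\frac{z_{\tau h}^{k+1}-z_{\tau h}^k}{\tau}\Big)\quad\text{for all }\tilde z\in\mathcal Z_h;$$ 3. $v_{\tau h}^{k+1}\in V_h$ with $\mathcal T'\dfrac{v_{\tau h}^{k+1}-v_{\tau h}^k}{\tau}+E_h^*S_{\tau h}^{k+1}=F_{\tau h}^{k+1}$, where $S_{\tau h}^{k+1}=\mathfrak C^*\varPhi'_\varSigma(\varSigma_{\tau h}^{k+1},z_{\tau h}^{k+1})$ (the equation being understood when tested by elements of $V_h$), and $u_{\tau h}^{k+1}=u_{\tau h}^k+\tau v_{\tau h}^{k+1}$. **Interpolants.** $z_{\tau h}(t)=\frac{t-(k-1)\tau}{\tau}z_{\tau h}^k+\frac{k\tau-t}{\tau}z_{\tau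 h}^{k-1}$ for $(k-1)\tau<t\le k\tau$ is the continuous piecewise affine interpolant of the values $z_{\tau h}^k$; $u_{\tau h},\varSigma_{\tau h},v_{\tau h}$ are defined analogously.
   Formalization: The formal theorem additionally assumes that the dissipation potential is finite at zero, Ψ(0) < +∞ (usually Ψ(0)=0); without it the claim fails, e.g. for Ψ identically +∞, where the inclusion for z is vacuous and z is unbounded. *)

theory Defs
  imports "HOL-Probability.Essential_Supremum"
begin

section \<open>Duality\<close>

type_synonym 'a dual = "'a \<Rightarrow>\<^sub>L real"

definition adjoint_op :: "('a::real_normed_vector \<Rightarrow>\<^sub>L 'b::real_normed_vector) \<Rightarrow> 'b dual \<Rightarrow> 'a dual" where
  "adjoint_op A f = f o\<^sub>L A"

definition findim_subspace :: "'a::real_vector set \<Rightarrow> bool" where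
  "findim_subspace V \<longleftrightarrow> (\<exists>B. finite B \<and> V = span B)"

section \<open>The operator \<open>E\<close> and the spaces \<open>\<U>\<close>, \<open>\<X>\<close>\<close>

text \<open>The operator \<open>E\<close> is defined on all of \<open>\<H>\<close> with values in a vector space
  \<open>'w\<close> that contains the Banach space \<open>\<E> = 'e\<close> by means of a linear injection \<open>j\<close>.\<close>

definition U_space :: "('h \<Rightarrow> 'w) \<Rightarrow> ('e \<Rightarrow> 'w) \<Rightarrow> 'h set" where
  "U_space E j = {u. E u \<in> range j}"

definition E_op :: "('h \<Rightarrow> 'w) \<Rightarrow> ('e \<Rightarrow> 'w) \<Rightarrow> 'h \<Rightarrow> 'e" where
  "E_op E j u = inv j (E u)"

definition U_norm :: "('h::real_normed_vector \<Rightarrow> 'w) \<Rightarrow> ('e::real_normed_vector \<Rightarrow> 'w) \<Rightarrow> 'h \<Rightarrow> real" where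
  "U_norm E j u = norm u + norm (E_op E j u)"

definition U_complete :: "('h::real_normed_vector \<Rightarrow> 'w) \<Rightarrow> ('e::real_normed_vector \<Rightarrow> 'w) \<Rightarrow> bool" where
  "U_complete E j \<longleftrightarrow>
     (\<forall>x::nat \<Rightarrow> 'h. (\<forall>n. x n \<in> U_space E j) \<and>
        (\<forall>e>0. \<exists>M. \<forall>m\<ge>M. \<forall>n\<ge>M. U_norm E j (x m - x n) < e) \<longrightarrow>
        (\<exists>l\<in>U_space E j. (\<lambda>n. U_norm E j (x n - l)) \<longlonglongrightarrow> 0))"

text \<open>The norm of \<open>\<U>\<^sup>*\<close>, evaluated on \<open>\<H>\<^sup>* \<subseteq> \<U>\<^sup>*\<close>.\<close>

definition U_dual_norm ::
    "('h::real_normed_vector \<Rightarrow> 'w) \<Rightarrow> ('e::real_normed_vector \<Rightarrow> 'w) \<Rightarrow> 'h dual \<Rightarrow> real" where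
  "U_dual_norm E j f = (SUP u\<in>{u \<in> U_space E j. U_norm E j u \<le> 1}. \<bar>blinfun_apply f u\<bar>)"

text \<open>For \<open>X \<in> \<S>\<^sup>*\<close> the functional \<open>E\<^sup>*\<CC>\<^sup>*X \<in> \<U>\<^sup>*\<close> is \<open>u \<mapsto> X (\<CC> (E u))\<close>. It belongs to
  \<open>\<H>\<^sup>*\<close> iff it is the restriction to \<open>\<U>\<close> of some \<open>w \<in> \<H>\<^sup>*\<close>; this \<open>w\<close> is unique because
  \<open>\<U>\<close> is dense in \<open>\<H>\<close>.\<close>

definition represents_EC ::
    "('h::real_normed_vector \<Rightarrow> 'w) \<Rightarrow> ('e::real_normed_vector \<Rightarrow> 'w) \<Rightarrow>
     ('e \<Rightarrow>\<^sub>L 's::real_normed_vector) \<Rightarrow> 's dual \<Rightarrow> 'h dual \<Rightarrow> bool" where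
  "represents_EC E j \<CC> X w \<longleftrightarrow>
     (\<forall>u\<in>U_space E j. blinfun_apply w u = blinfun_apply (adjoint_op \<CC> X) (E_op E j u))"

definition X_space ::
    "('h::real_normed_vector \<Rightarrow> 'w) \<Rightarrow> ('e::real_normed_vector \<Rightarrow> 'w) \<Rightarrow>
     ('e \<Rightarrow>\<^sub>L 's::real_normed_vector) \<Rightarrow> 's dual set" where
  "X_space E j \<CC> = {X. \<exists>w. represents_EC E j \<CC> X w}"

definition X_norm ::
    "('h::real_normed_vector \<Rightarrow> 'w) \<Rightarrow> ('e::real_normed_vector \<Rightarrow> 'w) \<Rightarrow>
     ('e \<Rightarrow>\<^sub>L 's::real_normed_vector) \<Rightarrow> 's dual \<Rightarrow> real" where
  "X_norm E j \<CC> X = norm X + norm (THE w. represents_EC E j \<CC> X w)"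

text \<open>The norm of \<open>\<X>\<^sup>*\<close>, evaluated on elements of \<open>\<S>\<close>.\<close>

definition X_dual_norm ::
    "('h::real_normed_vector \<Rightarrow> 'w) \<Rightarrow> ('e::real_normed_vector \<Rightarrow> 'w) \<Rightarrow>
     ('e \<Rightarrow>\<^sub>L 's::real_normed_vector) \<Rightarrow> 's \<Rightarrow> real" where
  "X_dual_norm E j \<CC> \<sigma> = (SUP X\<in>{X \<in> X_space E j \<CC>. X_norm E j \<CC> X \<le> 1}. \<bar>blinfun_apply X \<sigma>\<bar>)"

section \<open>Functionals\<close>

definition has_gateaux_derivative ::
    "('a::real_normed_vector \<Rightarrow> real) \<Rightarrow> 'a dual \<Rightarrow> 'a \<Rightarrow> bool" where
  "has_gateaux_derivative f D x \<longleftrightarrow>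
     (\<forall>d. ((\<lambda>r. (f (x + r *\<^sub>R d) - f x) / r) \<longlongrightarrow> blinfun_apply D d) (at 0))"

text \<open>Quadratic means a continuous polynomial of degree at most two; affine terms are allowed.\<close>

definition quadratic_fun :: "('a::real_normed_vector \<Rightarrow> real) \<Rightarrow> bool" where
  "quadratic_fun f \<longleftrightarrow>
     (\<exists>B L c. bounded_bilinear B \<and> bounded_linear L \<and> (\<forall>x. f x = B x x + L x + c))"

text \<open>\<open>C\<^sup>\<infinity>\<close> in the sense of Frechet: \<open>D x [h\<^sub>1, \<dots>, h\<^sub>n]\<close> is the \<open>n\<close>-th derivative at \<open>x\<close>,
  applied to \<open>h\<^sub>1, \<dots>, h\<^sub>n\<close>, a bounded \<open>n\<close>-linear form, and the \<open>(n+1)\<close>-st derivative is the Frechet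
  derivative of the \<open>n\<close>-th one with respect to the norm of \<open>n\<close>-linear forms.\<close>

definition smooth_fun :: "('a::real_normed_vector \<Rightarrow> real) \<Rightarrow> bool" where
  "smooth_fun f \<longleftrightarrow>
     (\<exists>D :: 'a \<Rightarrow> 'a list \<Rightarrow> real.
        (\<forall>x. D x [] = f x) \<and>
        (\<forall>x hs. linear (\<lambda>h. D x (h # hs))) \<and>
        (\<forall>x n. \<exists>K. \<forall>hs. length hs = n \<longrightarrow> \<bar>D x hs\<bar> \<le> K * prod_list (map norm hs)) \<and>
        (\<forall>x n. \<forall>e>0. \<exists>d>0. \<forall>h. norm h < d \<longrightarrow>
           (\<forall>hs. length hs = n \<longrightarrow>
              \<bar>D (x + h) hs - D x hs - D x (h # hs)\<bar> \<le> e * norm h * prod_list (map norm hs))))"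

definition convex_functional :: "('a::real_vector \<Rightarrow> ereal) \<Rightarrow> bool" where
  "convex_functional \<psi> \<longleftrightarrow>
     (\<forall>x y. \<forall>r\<in>{0..1}. \<psi> ((1 - r) *\<^sub>R x + r *\<^sub>R y) \<le> ereal (1 - r) * \<psi> x + ereal r * \<psi> y)"

definition lower_semicontinuous :: "('a::topological_space \<Rightarrow> ereal) \<Rightarrow> bool" where
  "lower_semicontinuous \<psi> \<longleftrightarrow> (\<forall>x. \<psi> x \<le> Liminf (at x) \<psi>)"

section \<open>Bochner and Bochner--Sobolev norms on \<open>[0, T]\<close>\<close>

text \<open>No separability of the spaces is assumed. The norm of the target space is the parameter
  \<open>nrm\<close>, because the norms of \<open>\<X>\<^sup>*\<close> and \<open>\<U>\<^sup>*\<close> are not the norm of the type. The norms below have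
  the value \<open>top\<close> on functions that do not belong to the space.\<close>

definition strongly_measurable :: "real \<Rightarrow> ('a \<Rightarrow> real) \<Rightarrow> (real \<Rightarrow> 'a::real_vector) \<Rightarrow> bool" where
  "strongly_measurable T nrm f \<longleftrightarrow>
     (\<exists>s. (\<forall>n::nat. simple_function (lebesgue_on {0..T}) (s n)) \<and>
          (AE t in lebesgue_on {0..T}. (\<lambda>n. nrm (s n t - f t)) \<longlonglongrightarrow> 0))"

definition Linf_norm :: "real \<Rightarrow> ('a \<Rightarrow> real) \<Rightarrow> (real \<Rightarrow> 'a::real_vector) \<Rightarrow> ennreal" where
  "Linf_norm T nrm f =
     (if strongly_measurable T nrm f
      then esssup (lebesgue_on {0..T}) (\<lambda>t. ennreal (nrm (f t))) else top)"

definition Lp_norm :: "real \<Rightarrow> real \<Rightarrow> ('a \<Rightarrow> real) \<Rightarrow> (real \<Rightarrow> 'a::real_vector) \<Rightarrow> ennreal" where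
  "Lp_norm T p nrm f =
     (let I = (\<integral>\<^sup>+ t. ennreal (nrm (f t) powr p) \<partial>lebesgue_on {0..T})
      in if strongly_measurable T nrm f \<and> I < top then ennreal (enn2real I powr (1 / p)) else top)"

definition time_deriv :: "(real \<Rightarrow> 'a::real_normed_vector) \<Rightarrow> real \<Rightarrow> 'a" where
  "time_deriv f t = vector_derivative f (at t)"

text \<open>The (absolutely continuous representatives of) functions in \<open>W\<^sup>1\<^sup>,\<^sup>1\<close>, with values in an arbitrary
  Banach space, are exactly the a.e. differentiable functions with Bochner integrable derivative that
  are the integral of this derivative. The integral below is the gauge integral, which extends the
  Bochner integral; Bochner integrability is imposed in the norms.\<close>

definition integral_of_deriv :: "real \<Rightarrow> (real \<Rightarrow> 'a::real_normed_vector) \<Rightarrow> bool" where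
  "integral_of_deriv T f \<longleftrightarrow>
     (AE t in lebesgue_on {0..T}. f differentiable (at t)) \<and>
     (\<forall>t\<in>{0..T}. (time_deriv f has_integral (f t - f 0)) {0..t})"

definition W11_norm :: "real \<Rightarrow> (real \<Rightarrow> 'a::real_normed_vector) \<Rightarrow> ennreal" where
  "W11_norm T f =
     (if integral_of_deriv T f then Lp_norm T 1 norm f + Lp_norm T 1 norm (time_deriv f) else top)"

definition W1inf_norm :: "real \<Rightarrow> (real \<Rightarrow> 'a::real_normed_vector) \<Rightarrow> ennreal" where
  "W1inf_norm T f =
     (if integral_of_deriv T f then Linf_norm T norm f + Linf_norm T norm (time_deriv f) else top)"

section \<open>The staggered scheme\<close>

definition time_steps :: "real \<Rightarrow> real set" where
  "time_steps T = {\<tau>. 0 < \<tau> \<and> T / \<tau> \<in> \<nat>}"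

text \<open>Here \<open>G\<close> plays the role of \<open>G\<^sub>h\<close>; the maximum realises \<open>G\<^sub>h t = G\<^sub>h 0\<close> for \<open>t < 0\<close>.\<close>

definition load_rate :: "(real \<Rightarrow> 's::real_normed_vector) \<Rightarrow> real \<Rightarrow> nat \<Rightarrow> 's" where
  "load_rate G \<tau> k =
     (1 / \<tau>) *\<^sub>R (G (max 0 ((real k + 1 / 2) * \<tau>)) - G (max 0 ((real k - 1 / 2) * \<tau>)))"

text \<open>Arguments: final time and time step; the spaces \<open>V\<^sub>h\<close>, \<open>\<S>\<^sub>h\<close>, \<open>\<Z>\<^sub>h\<close>; the operators \<open>\<CC>\<close>, \<open>E\<^sub>h\<close>,
  \<open>\<T>'\<close>; the partial derivatives \<open>\<Phi>'\<^sub>\<Sigma>\<close>, \<open>\<Phi>'\<^sub>z\<close>; the potential \<open>\<Psi>\<close>; the loads \<open>F\<^sub>h\<close>, \<open>G\<^sub>h\<close>; the discrete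
  solution \<open>(u\<^sup>k, \<Sigma>\<^sup>k, v\<^sup>k, z\<^sup>k)\<close> for \<open>0 \<le> k \<le> T/\<tau>\<close>.\<close>

definition staggered_solution ::
    "real \<Rightarrow> real \<Rightarrow> 'h::real_inner set \<Rightarrow> 's::real_normed_vector set \<Rightarrow> 'z::real_normed_vector set \<Rightarrow>
     ('e::real_normed_vector \<Rightarrow>\<^sub>L 's) \<Rightarrow> ('h \<Rightarrow>\<^sub>L 'e) \<Rightarrow> ('h \<Rightarrow>\<^sub>L 'h dual) \<Rightarrow>
     ('s \<Rightarrow> 'z \<Rightarrow> 's dual) \<Rightarrow> ('s \<Rightarrow> 'z \<Rightarrow> 'z dual) \<Rightarrow> ('z \<Rightarrow> ereal) \<Rightarrow>
     'h dual \<Rightarrow> (real \<Rightarrow> 's) \<Rightarrow>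
     (nat \<Rightarrow> 'h) \<Rightarrow> (nat \<Rightarrow> 's) \<Rightarrow> (nat \<Rightarrow> 'h) \<Rightarrow> (nat \<Rightarrow> 'z) \<Rightarrow> bool" where
  "staggered_solution T \<tau> Vh Sh Zh \<CC> Eh T' \<Phi>S \<Phi>Z \<Psi> Fh Gh u \<Sigma> v z \<longleftrightarrow>
     (\<forall>k. real k < T / \<tau> \<longrightarrow>
        (\<Sigma> (Suc k) \<in> Sh \<and>
         (1 / \<tau>) *\<^sub>R (\<Sigma> (Suc k) - \<Sigma> k) =
           blinfun_apply \<CC> (blinfun_apply Eh (v k)) + load_rate Gh \<tau> k) \<and>
        (z (Suc k) \<in> Zh \<and>
         (\<forall>z'\<in>Zh.
            \<Psi> z' + ereal (blinfun_apply (\<Phi>Z (\<Sigma> (Suc k)) ((1 / 2) *\<^sub>R (z (Suc k) + z k)))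
                        (z' - (1 / \<tau>) *\<^sub>R (z (Suc k) - z k)))
              \<ge> \<Psi> ((1 / \<tau>) *\<^sub>R (z (Suc k) - z k)))) \<and>
        (v (Suc k) \<in> Vh \<and>
         (\<forall>w\<in>Vh.
            blinfun_apply (blinfun_apply T' ((1 / \<tau>) *\<^sub>R (v (Suc k) - v k))) w
            + blinfun_apply (adjoint_op Eh (adjoint_op \<CC> (\<Phi>S (\<Sigma> (Suc k)) (z (Suc k))))) w
            = blinfun_apply Fh w)) \<and>
        u (Suc k) = u k + \<tau> *\<^sub>R v (Suc k))"

text \<open>The CFL condition for one time step \<open>\<tau>\<close> and one spatial discretisation.\<close>

definition CFL ::
    "real \<Rightarrow> real \<Rightarrow> 's::real_normed_vector set \<Rightarrow> 'z set \<Rightarrow>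
     ('e::real_normed_vector \<Rightarrow>\<^sub>L 's) \<Rightarrow> ('h::real_inner \<Rightarrow>\<^sub>L 'e) \<Rightarrow> ('h \<Rightarrow>\<^sub>L 'h dual) \<Rightarrow>
     ('s \<Rightarrow> 'z \<Rightarrow> real) \<Rightarrow> ('s \<Rightarrow> 'z \<Rightarrow> 's dual) \<Rightarrow> bool" where
  "CFL \<eta> \<tau> Sh Zh \<CC> Eh T' \<Phi> \<Phi>S \<longleftrightarrow>
     (\<forall>\<sigma>\<in>Sh. \<forall>z\<in>Zh. \<forall>z'\<in>Zh.
        let f = adjoint_op Eh (adjoint_op \<CC> (\<Phi>S \<sigma> z'))
        in \<Phi> \<sigma> z \<ge> \<tau>\<^sup>2 / (4 - \<eta>) * blinfun_apply f (inv (blinfun_apply T') f))"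

text \<open>For \<open>t \<le> 0\<close> the index \<open>k\<close> is \<open>0\<close>, so that \<open>k - 1 = 0\<close>, and the value is \<open>w 0\<close>.\<close>

definition affine_interp :: "real \<Rightarrow> (nat \<Rightarrow> 'a::real_vector) \<Rightarrow> real \<Rightarrow> 'a" where
  "affine_interp \<tau> w t =
     (let k = nat \<lceil>t / \<tau>\<rceil>
      in ((t - (real k - 1) * \<tau>) / \<tau>) *\<^sub>R w k + ((real k * \<tau> - t) / \<tau>) *\<^sub>R w (k - 1))"

end

theory Submission
  imports Defs
begin

text \<open>The discrete energy
  \<open>e\<^sup>k = \<langle>\<T>'v\<^sup>k\<^sup>+\<^sup>1, v\<^sup>k\<rangle> / 2 + \<Phi>(\<Sigma>\<^sup>k\<^sup>+\<^sup>1, z\<^sup>k\<^sup>+\<^sup>1)\<close> is nearly conserved: test the momentum equations at the two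
  levels \<open>k\<close> and \<open>k + 1\<close> by \<open>v\<^sup>k\<^sup>+\<^sup>1\<close> and the flow rule by \<open>0\<close>, and use that increments of quadratic
  functionals are given exactly by midpoint and trapezoidal derivatives. The only defect is the change of
  \<open>\<Phi>'\<^sub>\<Sigma>\<close> with \<open>z\<close>; by the Lipschitz estimate it is absorbed in the dissipation. Testing the momentum
  equation by the discrete acceleration bounds the latter by \<open>1 + \<parallel>\<Sigma>\<parallel> + \<parallel>z\<parallel>\<close>, as the \<open>E\<^sub>h\<close> are uniformly
  bounded on \<open>\<H>\<close>; hence \<open>e\<^sup>k\<close> is coercive for small \<open>\<tau>\<close>, and Gronwall's inequality applies.\<close>

section \<open>Measurability and norms of affine interpolants\<close>

text \<open>The stress update is explicit: \<open>\<Sigma>\<close> at level k + 1 is driven by the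
  velocity at level k. Testing by the velocity at level k + 1 thus produces the stress increment
  from k + 1 to k + 2, and the accelerations of both levels add up to a centred difference, which
  telescopes only as the product of consecutive velocities. This product has no sign, hence the care
  for coercivity. Two obstacles shape the rest. The load rate is merely integrable in time, so its
  share in one step is not O(\<tau>) and may multiply only square roots of the energy. The energy
  couples two levels, so its balance starts after the first step, which has to be estimated from the
  data.\<close>

lemma measurable_lebesgue_on_AE_cong:
  fixes f g :: "'a::euclidean_space \<Rightarrow> 'b::topological_space"
  assumes S: "S \<in> sets lebesgue" and f: "f \<in> borel_measurable (lebesgue_on S)"
    and ae: "AE x in lebesgue_on S. f x = g x"
  shows "g \<in> borel_measurable (lebesgue_on S)"
proof (rule measurableI)
  fix A :: "'b set" assume A: "A \<in> sets borel"
  define N where "N = {x \<in> S. f x \<noteq> g x}"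
  have "AE x in lebesgue. x \<in> S \<longrightarrow> f x = g x"
    using ae S by (subst (asm) AE_restrict_space_iff) auto
  then have "AE x in lebesgue. x \<notin> N"
    by (rule AE_mp) (auto simp: N_def)
  then have "N \<in> null_sets lebesgue"
    by (simp add: AE_iff_null_sets null_sets_completionI completion.AE_iff_null_sets)
  \<comment> \<open>Completeness of Lebesgue measure: every subset of the null set on which
    \<open>f\<close> and \<open>g\<close> differ is measurable.\<close>
  then have sub: "M \<in> sets lebesgue" if "M \<subseteq> N" for M
    using that completion.complete by blast
  have fm: "f -` A \<inter> S \<in> sets lebesgue"
    using measurable_sets[OF f A] S by (auto simp: sets_restrict_space_iff)
  have "g -` A \<inter> S = (f -` A \<inter> S - (N \<inter> f -` A)) \<union> (N \<inter> g -` A)"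
    by (auto simp: N_def)
  also have "\<dots> \<in> sets lebesgue"
    by (intro sets.Un sets.Diff fm sub) auto
  finally show "g -` A \<inter> space (lebesgue_on S) \<in> sets (lebesgue_on S)"
    using S by (simp add: sets_restrict_space_iff)
qed simp

text \<open>Convergence holds only almost everywhere, so the limit of the norms is replaced by their
  liminf in \<open>ennreal\<close>, which is measurable everywhere and differs from the norm of
  \<open>f\<close> only on a null set.\<close>

lemma strongly_measurable_norm_measurable:
  assumes "strongly_measurable T norm (f :: real \<Rightarrow> 'a::real_normed_vector)"
  shows "(\<lambda>t. norm (f t)) \<in> borel_measurable (lebesgue_on {0..T})"
proof -
  let ?M = "lebesgue_on {0..T}"
  obtain s where s: "\<And>n::nat. simple_function ?M (s n)"
    and lim: "AE t in ?M. (\<lambda>n. norm (s n t - f t)) \<longlonglongrightarrow> 0"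
    using assms unfolding strongly_measurable_def by blast
  have m: "(\<lambda>t. ennreal (norm (s n t))) \<in> borel_measurable ?M" for n
    by (rule borel_measurable_simple_function, rule simple_function_compose1[OF s])
  have "(\<lambda>t. liminf (\<lambda>n. ennreal (norm (s n t)))) \<in> borel_measurable ?M"
    using m by measurable
  moreover have "AE t in ?M. liminf (\<lambda>n. ennreal (norm (s n t))) = ennreal (norm (f t))"
    using lim
  proof (rule AE_mp, intro AE_I2 impI)
    fix t assume "(\<lambda>n. norm (s n t - f t)) \<longlonglongrightarrow> 0"
    then have "(\<lambda>n. s n t) \<longlonglongrightarrow> f t"
      by (simp add: LIM_zero_iff tendsto_norm_zero_iff)
    then have "(\<lambda>n. ennreal (norm (s n t))) \<longlonglongrightarrow> ennreal (norm (f t))"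
      by (intro tendsto_ennrealI tendsto_norm)
    then show "liminf (\<lambda>n. ennreal (norm (s n t))) = ennreal (norm (f t))"
      by (simp add: lim_imp_Liminf)
  qed
  ultimately have "(\<lambda>t. ennreal (norm (f t))) \<in> borel_measurable ?M"
    by (rule measurable_lebesgue_on_AE_cong[rotated]) simp
  then have "(\<lambda>t. enn2real (ennreal (norm (f t)))) \<in> borel_measurable ?M"
    by measurable
  then show ?thesis by simp
qed

text \<open>Increments of \<open>G\<close> are integrals of its derivative, so their norms sum up to
  at most the L1 norm of the derivative. The increments come as gauge integrals, the norm as a
  Lebesgue integral; the comparison is made on the gauge side.\<close>

lemma variation_le_W11_norm:
  fixes G :: "real \<Rightarrow> 'a::banach"
  assumes W: "W11_norm T G \<le> ennreal M" and M: "M \<ge> 0"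
    and a: "\<And>k. k \<le> N \<Longrightarrow> a k \<in> {0..T}" and mono: "\<And>k. k < N \<Longrightarrow> a k \<le> a (Suc k)"
  shows "(\<Sum>k<N. norm (G (a (Suc k)) - G (a k))) \<le> M"
proof -
  let ?M = "lebesgue_on {0..T}"
  define g where "g = (\<lambda>t. norm (time_deriv G t))"
  have id: "integral_of_deriv T G"
    using W by (auto simp: W11_norm_def top_unique split: if_splits)
  then have "Lp_norm T 1 norm G + Lp_norm T 1 norm (time_deriv G) \<le> ennreal M"
    using W by (simp add: W11_norm_def)
  then have L1: "Lp_norm T 1 norm (time_deriv G) \<le> ennreal M"
    by (rule order_trans[rotated]) simp
  define J where "J = (\<integral>\<^sup>+ t. ennreal (g t) \<partial>?M)"
  have "strongly_measurable T norm (time_deriv G)" and J: "J < top" "ennreal (enn2real J) \<le> ennreal M"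
    using L1 by (auto simp: Lp_norm_def Let_def J_def g_def top_unique split: if_splits)
  then have gm: "g \<in> borel_measurable ?M"
    unfolding g_def using strongly_measurable_norm_measurable by blast
  have gint: "integrable ?M g"
    using gm J(1) by (intro integrableI_nonneg) (auto simp: J_def g_def)
  have "ennreal (integral\<^sup>L ?M g) = J"
    unfolding J_def using gint by (intro nn_integral_eq_integral[symmetric]) (auto simp: g_def)
  then have "integral\<^sup>L ?M g \<le> M" using J M
    by (metis ennreal_enn2real ennreal_le_iff order_refl)
  moreover have gint': "g integrable_on {0..T}"
    using gint by (simp add: integrable_on_lebesgue_on)
  moreover have "integral\<^sup>L ?M g = integral {0..T} g"
    using gint by (intro lebesgue_integral_eq_integral) auto
  ultimately have gM: "integral {0..T} g \<le> M" by simp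
  have g_on: "g integrable_on {x..y}" if "0 \<le> x" "y \<le> T" for x y
    using integrable_subinterval_real[OF gint', of x y] that by simp
  have step: "norm (G y - G x) \<le> integral {0..y} g - integral {0..x} g" if "0 \<le> x" "x \<le> y" "y \<le> T" for x y
  proof -
    have hx: "(time_deriv G has_integral (G x - G 0)) {0..x}" and hy: "(time_deriv G has_integral (G y - G 0)) {0..y}"
      using id that by (auto simp: integral_of_deriv_def)
    have int: "time_deriv G integrable_on {x..y}"
      using integrable_subinterval_real[OF has_integral_integrable[OF hy], of x y] that by simp
    have gi: "g integrable_on {0..y}"
      using g_on[of 0 y] that by simp
    have "integral {0..x} (time_deriv G) + integral {x..y} (time_deriv G) = integral {0..y} (time_deriv G)"
      by (rule Henstock_Kurzweil_Integration.integral_combine[OF that(1,2) has_integral_integrable[OF hy]])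
    then have "G y - G x = integral {x..y} (time_deriv G)"
      using integral_unique[OF hx] integral_unique[OF hy] by (simp add: algebra_simps)
    also have "norm \<dots> \<le> integral {x..y} g"
      using int g_on[OF that(1,3)]
      by (rule Henstock_Kurzweil_Integration.integral_norm_bound_integral) (simp add: g_def)
    also have "\<dots> = integral {0..y} g - integral {0..x} g"
      using Henstock_Kurzweil_Integration.integral_combine[OF that(1,2) gi] by simp
    finally show ?thesis .
  qed
  \<comment> \<open>Writing each bound as a difference of integrals from 0 lets the sum
    telescope.\<close>
  have "n \<le> N \<Longrightarrow> (\<Sum>k<n. norm (G (a (Suc k)) - G (a k))) \<le> integral {0..a n} g - integral {0..a 0} g" for n
  proof (induction n)
    case (Suc n)
    then show ?case
      using step[of "a n" "a (Suc n)"] a[of n] a[of "Suc n"] mono[of n] by auto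
  qed simp
  from this[of N] have "(\<Sum>k<N. norm (G (a (Suc k)) - G (a k))) \<le> integral {0..a N} g - integral {0..a 0} g"
    by simp
  also have "\<dots> \<le> integral {0..T} g"
  proof -
    have "integral {0..a N} g \<le> integral {0..T} g"
      using a[of N] by (intro integral_subset_le g_on gint') (auto simp: g_def)
    moreover have "0 \<le> integral {0..a 0} g"
      using a[of 0] by (intro integral_nonneg g_on) (auto simp: g_def)
    ultimately show ?thesis by simp
  qed
  finally show ?thesis using gM by simp
qed

text \<open>The midpoints of the steps, cut off at 0, form a partition that does not pass the final
  time. For k = 0 the increment covers only half a step.\<close>

lemma sum_load_rate_le:
  fixes G :: "real \<Rightarrow> 'a::banach"
  assumes "W11_norm (real N * \<tau>) G \<le> ennreal M" "M \<ge> 0" "\<tau> > 0"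
  shows "(\<Sum>k<N. \<tau> * norm (load_rate G \<tau> k)) \<le> M"
proof -
  define a where "a k = max 0 ((real k - 1 / 2) * \<tau>)" for k
  have "(\<Sum>k<N. \<tau> * norm (load_rate G \<tau> k)) = (\<Sum>k<N. norm (G (a (Suc k)) - G (a k)))"
  proof (intro sum.cong refl)
    fix k
    have "max 0 ((real k + 1 / 2) * \<tau>) = a (Suc k)" by (simp add: a_def algebra_simps)
    then have "load_rate G \<tau> k = (1 / \<tau>) *\<^sub>R (G (a (Suc k)) - G (a k))"
      by (simp add: load_rate_def a_def)
    then show "\<tau> * norm (load_rate G \<tau> k) = norm (G (a (Suc k)) - G (a k))"
      using \<open>\<tau> > 0\<close> by simp
  qed
  also have "\<dots> \<le> M"
  proof (intro variation_le_W11_norm[OF assms(1,2)])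
    fix k assume "k \<le> N"
    then have "(real k - 1 / 2) * \<tau> \<le> real N * \<tau>" using \<open>\<tau> > 0\<close> by (intro mult_right_mono) auto
    then show "a k \<in> {0..real N * \<tau>}" using \<open>\<tau> > 0\<close> by (simp add: a_def)
  next
    fix k show "a k \<le> a (Suc k)"
      unfolding a_def using \<open>\<tau> > 0\<close> by (intro max.mono mult_right_mono) auto
  qed
  finally show ?thesis .
qed

section \<open>Grid points and piecewise affine interpolants\<close>

lemma AE_in_open_step:
  assumes "\<tau> > 0"
  shows "AE t in lebesgue_on {0..real N * \<tau>}. \<exists>k<N. real k * \<tau> < t \<and> t < real (Suc k) * \<tau>"
proof (rule AE_I')
  let ?F = "(\<lambda>k. real k * \<tau>) ` {..N}"
  show "?F \<inter> {0..real N * \<tau>} \<in> null_sets (lebesgue_on {0..real N * \<tau>})"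
    by (subst null_sets_restrict_space) (auto intro!: null_sets_completionI finite_imp_null_set_lborel)
  show "{t \<in> space (lebesgue_on {0..real N * \<tau>}). \<not> (\<exists>k<N. real k * \<tau> < t \<and> t < real (Suc k) * \<tau>)}
        \<subseteq> ?F \<inter> {0..real N * \<tau>}"
  proof safe
    fix t assume t: "t \<in> space (lebesgue_on {0..real N * \<tau>})"
      and n: "\<not> (\<exists>k<N. real k * \<tau> < t \<and> t < real (Suc k) * \<tau>)"
    have t0: "0 \<le> t" "t \<le> real N * \<tau>" using t by auto
    define k where "k = nat \<lfloor>t / \<tau>\<rfloor>"
    have "0 \<le> t / \<tau>" using t0 assms by simp
    then have k: "real k \<le> t / \<tau>" "t / \<tau> < real k + 1"
      unfolding k_def by linarith+
    then have kt: "real k * \<tau> \<le> t" "t < real (Suc k) * \<tau>"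
      using assms by (auto simp: field_simps)
    have "real k \<le> real N" using kt(1) t0(2) assms
      by (meson le_divide_eq order_trans mult_le_cancel_right_pos)
    then have "k \<le> N" by simp
    show "t \<in> ?F"
    proof (cases "t = real k * \<tau>")
      case True then show ?thesis using \<open>k \<le> N\<close> by auto
    next
      case False
      then have "\<not> k < N" using n kt by auto
      then have "k = N" using \<open>k \<le> N\<close> by simp
      then show ?thesis using kt t0 by auto
    qed
  qed auto
qed

text \<open>At the left end of the step the ceiling in \<open>affine_interp\<close> selects index k
  instead of k + 1; both formulas agree there, so the identity holds on the closed step, as gluing
  requires.\<close>

lemma affine_interp_eq:
  assumes "\<tau> > 0" "real k * \<tau> \<le> t" "t \<le> real (Suc k) * \<tau>"
  shows "affine_interp \<tau> w t = w k + ((t - real k * \<tau>) / \<tau>) *\<^sub>R (w (Suc k) - w k)"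
proof (cases "t = real k * \<tau>")
  case True
  then have "nat \<lceil>t / \<tau>\<rceil> = k" using assms by simp
  then show ?thesis using True assms by (simp add: affine_interp_def algebra_simps)
next
  case False
  then have "real k < t / \<tau>" "t / \<tau> \<le> real k + 1" using assms by (auto simp: field_simps)
  then have "nat \<lceil>t / \<tau>\<rceil> = Suc k"  by linarith
  moreover define r where "r = (t - real k * \<tau>) / \<tau>"
  moreover have "(real (Suc k) * \<tau> - t) / \<tau> = 1 - r"
    using assms by (simp add: r_def field_simps)
  ultimately have "affine_interp \<tau> w t = r *\<^sub>R w (Suc k) + (1 - r) *\<^sub>R w k"
    by (simp add: affine_interp_def Let_def)
  then show ?thesis unfolding r_def[symmetric] by (simp add: algebra_simps)
qed

lemma time_deriv_affine_interp:
  assumes "\<tau> > 0" "real k * \<tau> < t" "t < real (Suc k) * \<tau>"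
  shows "(affine_interp \<tau> w has_vector_derivative (1 / \<tau>) *\<^sub>R (w (Suc k) - w k)) (at t)"
    and "time_deriv (affine_interp \<tau> w) t = (1 / \<tau>) *\<^sub>R (w (Suc k) - w k)"
proof -
  let ?g = "\<lambda>t. w k + ((t - real k * \<tau>) / \<tau>) *\<^sub>R (w (Suc k) - w k)"
  have "(?g has_vector_derivative (1 / \<tau>) *\<^sub>R (w (Suc k) - w k)) (at t)"
    using \<open>\<tau> > 0\<close> by (auto intro!: derivative_eq_intros simp: has_vector_derivative_def divide_simps)
  then show "(affine_interp \<tau> w has_vector_derivative (1 / \<tau>) *\<^sub>R (w (Suc k) - w k)) (at t)"
    by (rule has_vector_derivative_transform_within_open[where S = "{real k * \<tau><..<real (Suc k) * \<tau>}"])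
       (use assms in \<open>auto intro!: affine_interp_eq[symmetric]\<close>)
  then show "time_deriv (affine_interp \<tau> w) t = (1 / \<tau>) *\<^sub>R (w (Suc k) - w k)"
    unfolding time_deriv_def by (rule vector_derivative_at)
qed

lemma continuous_on_affine_interp:
  fixes w :: "nat \<Rightarrow> 'a::real_normed_vector"
  assumes "\<tau> > 0"
  shows "continuous_on {0..real N * \<tau>} (affine_interp \<tau> w)"
proof (induction N)
  case (Suc N)
  have "continuous_on {real N * \<tau>..real (Suc N) * \<tau>}
      (\<lambda>t. w N + ((t - real N * \<tau>) / \<tau>) *\<^sub>R (w (Suc N) - w N))"
    using assms by (intro continuous_intros) auto
  then have "continuous_on {real N * \<tau>..real (Suc N) * \<tau>} (affine_interp \<tau> w)"
    by (rule continuous_on_eq) (use assms in \<open>auto simp: affine_interp_eq\<close>)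
  with Suc have "continuous_on ({0..real N * \<tau>} \<union> {real N * \<tau>..real (Suc N) * \<tau>}) (affine_interp \<tau> w)"
    by (intro continuous_on_closed_Un) auto
  moreover have "{0..real N * \<tau>} \<union> {real N * \<tau>..real (Suc N) * \<tau>} = {0..real (Suc N) * \<tau>}"
    using assms by (intro ivl_disj_un_two_touch(4)) (auto intro: mult_right_mono)
  ultimately show ?case by simp
qed simp

lemma norm_affine_interp_le:
  fixes w :: "nat \<Rightarrow> 'a::real_normed_vector"
  assumes "\<tau> > 0" "t \<in> {0..real N * \<tau>}" and w: "\<And>k. k \<le> N \<Longrightarrow> norm (w k) \<le> C"
  shows "norm (affine_interp \<tau> w t) \<le> C"
proof (cases "t = 0")
  case True
  then show ?thesis using affine_interp_eq[of \<tau> 0 t w] w[of 0] assms by simp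
next
  case False
  \<comment> \<open>The ceiling, not the floor: at the final time it yields step N - 1, so that
    \<open>Suc k\<close> stays at most N.\<close>
  define k where "k = nat \<lceil>t / \<tau>\<rceil> - 1"
  have "0 < t / \<tau>" "t / \<tau> \<le> real N" using False assms by (auto simp: field_simps)
  then have k: "real k < t / \<tau>" "t / \<tau> \<le> real (Suc k)" "Suc k \<le> N"
    unfolding k_def by linarith+
  define r where "r = (t - real k * \<tau>) / \<tau>"
  have r: "0 \<le> r" "r \<le> 1" using k assms by (auto simp: r_def field_simps)
  have "affine_interp \<tau> w t = w k + r *\<^sub>R (w (Suc k) - w k)"
    unfolding r_def using k assms by (intro affine_interp_eq) (auto simp: field_simps)
  also have "\<dots> = (1 - r) *\<^sub>R w k + r *\<^sub>R w (Suc k)" by (simp add: algebra_simps)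
  also have "norm \<dots> \<le> (1 - r) * C + r * C"
    using r k w[of k] w[of "Suc k"]
    by (intro norm_triangle_le add_mono) (auto intro: mult_left_mono)
  finally show ?thesis by (simp add: algebra_simps)
qed

text \<open>Once the range of this index is finite, any function of it is again simple, with no
  measurable structure on the values. Rounding to a grid therefore gives simple functions into
  arbitrary vector spaces.\<close>

lemma simple_function_finite_floor:
  assumes "S \<in> sets lebesgue" "bounded S"
  shows "simple_function (lebesgue_on S) (\<lambda>t::real. \<lfloor>c * t\<rfloor>)"
proof -
  obtain B where B: "\<And>t. t \<in> S \<Longrightarrow> \<bar>t\<bar> \<le> B" using assms by (auto simp: bounded_iff)
  have "(\<lambda>t. \<lfloor>c * t\<rfloor>) ` S \<subseteq> {-(\<lceil>\<bar>c\<bar> * B\<rceil> + 1)..\<lceil>\<bar>c\<bar> * B\<rceil> + 1}"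
  proof safe
    fix t assume "t \<in> S"
    then have "\<bar>c * t\<bar> \<le> \<bar>c\<bar> * B" using B by (simp add: abs_mult mult_left_mono)
    then show "\<lfloor>c * t\<rfloor> \<in> {-(\<lceil>\<bar>c\<bar> * B\<rceil> + 1)..\<lceil>\<bar>c\<bar> * B\<rceil> + 1}"
      by (auto; linarith)
  qed
  then have fin: "finite ((\<lambda>t. \<lfloor>c * t\<rfloor>) ` S)" by (rule finite_subset) simp
  have "(\<lambda>t::real. \<lfloor>c * t\<rfloor>) \<in> borel \<rightarrow>\<^sub>M count_space UNIV" by measurable
  then have "(\<lambda>t. \<lfloor>c * t\<rfloor>) \<in> lebesgue_on S \<rightarrow>\<^sub>M count_space UNIV"
    by (intro measurable_restrict_space1 measurable_completion) simp
  then show ?thesis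
    using fin measurable_sets[of _ "lebesgue_on S" "count_space UNIV"] by (subst simple_function_def) auto
qed

text \<open>Sampling at the last point not above t of the grid of mesh 1/(n + 1): the sample stays
  in the interval because the grid contains its left end 0, and continuity gives
  convergence.\<close>

lemma strongly_measurable_continuous:
  fixes f :: "real \<Rightarrow> 'a::real_normed_vector"
  assumes f: "continuous_on {0..T} f"
  shows "strongly_measurable T norm f"
  unfolding strongly_measurable_def
proof (intro exI conjI allI AE_I2)
  let ?r = "\<lambda>n t. real_of_int \<lfloor>real (Suc n) * t\<rfloor> / real (Suc n)"
  fix n show "simple_function (lebesgue_on {0..T}) (\<lambda>t. f (?r n t))"
    by (rule simple_function_compose1[where g = "\<lambda>i. f (real_of_int i / real (Suc n))"],
        rule simple_function_finite_floor) auto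
next
  let ?r = "\<lambda>n t. real_of_int \<lfloor>real (Suc n) * t\<rfloor> / real (Suc n)"
  fix t assume "t \<in> space (lebesgue_on {0..T})"
  then have t: "t \<in> {0..T}" by simp
  have r: "t - 1 / real (Suc n) \<le> ?r n t" "?r n t \<le> t" "0 \<le> ?r n t" for n
  proof -
    have "real (Suc n) * t - 1 \<le> real_of_int \<lfloor>real (Suc n) * t\<rfloor>" by linarith
    then have "(real (Suc n) * t - 1) / real (Suc n) \<le> ?r n t" by (intro divide_right_mono) auto
    then show "t - 1 / real (Suc n) \<le> ?r n t" by (simp add: diff_divide_distrib)
    have "real_of_int \<lfloor>real (Suc n) * t\<rfloor> \<le> real (Suc n) * t" by linarith
    then show "?r n t \<le> t" by (simp add: pos_divide_le_eq mult.commute)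
    show "0 \<le> ?r n t" using t by simp
  qed
  have "(\<lambda>n. 1 / real (Suc n)) \<longlonglongrightarrow> 0" by (rule LIMSEQ_Suc) (rule lim_1_over_n)
  from tendsto_diff[OF tendsto_const this, of t]
  have low: "(\<lambda>n. t - 1 / real (Suc n)) \<longlonglongrightarrow> t" by simp
  have "(\<lambda>n. ?r n t) \<longlonglongrightarrow> t"
    by (rule tendsto_sandwich[OF always_eventually always_eventually low tendsto_const]) (use r(1,2) in blast)+
  moreover have "?r n t \<in> {0..T}" for n
    using r(3) t by (simp only: atLeastAtMost_iff) (blast intro: order_trans[OF r(2)])
  ultimately have "(\<lambda>n. f (?r n t)) \<longlonglongrightarrow> f t"
    using t by (intro continuous_on_tendsto_compose[OF f] always_eventually allI)
  then show "(\<lambda>n. norm (f (?r n t) - f t)) \<longlonglongrightarrow> 0"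
    by (simp add: LIM_zero tendsto_norm_zero)
qed

lemma Linf_norm_affine_interp_le:
  fixes w :: "nat \<Rightarrow> 'a::real_normed_vector"
  assumes "\<tau> > 0" and w: "\<And>k. k \<le> N \<Longrightarrow> norm (w k) \<le> C"
  shows "Linf_norm (real N * \<tau>) norm (affine_interp \<tau> w) \<le> ennreal C"
proof -
  have c: "continuous_on {0..real N * \<tau>} (affine_interp \<tau> w)"
    using assms by (intro continuous_on_affine_interp)
  have "(\<lambda>t. ennreal (norm (affine_interp \<tau> w t))) \<in> borel_measurable (lebesgue_on {0..real N * \<tau>})"
    by (rule measurable_compose[OF continuous_imp_measurable_on_sets_lebesgue measurable_ennreal])
       (use c in \<open>auto intro: continuous_intros\<close>)
  moreover have "AE t in lebesgue_on {0..real N * \<tau>}. ennreal (norm (affine_interp \<tau> w t)) \<le> ennreal C"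
    using assms by (intro AE_I2) (auto intro!: ennreal_leI norm_affine_interp_le[where N=N])
  ultimately show ?thesis
    unfolding Linf_norm_def using strongly_measurable_continuous[OF c] by (auto intro: esssup_I)
qed

text \<open>Models the time derivatives of interpolants, whose values at grid points are left open.
  \<open>nrm\<close> is arbitrary up to its value at 0, so that the dual norms are covered; that
  value makes a constant sequence of simple functions an approximation in
  \<open>nrm\<close>.\<close>

locale step_function =
  fixes \<tau> :: real and N :: nat and nrm :: "'a::real_vector \<Rightarrow> real" and f :: "real \<Rightarrow> 'a" and c :: "nat \<Rightarrow> 'a"
  assumes tau: "\<tau> > 0" and nrm_0: "nrm 0 = 0"
    and step: "\<And>k t. k < N \<Longrightarrow> real k * \<tau> < t \<Longrightarrow> t < real (Suc k) * \<tau> \<Longrightarrow> f t = c k"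
begin

lemma AE_eq_simple:
  obtains s where "simple_function (lebesgue_on {0..real N * \<tau>}) s"
    "AE t in lebesgue_on {0..real N * \<tau>}. s t = f t"
proof
  let ?s = "\<lambda>t. c (nat \<lfloor>(1 / \<tau>) * t\<rfloor>)"
  show "simple_function (lebesgue_on {0..real N * \<tau>}) ?s"
    by (rule simple_function_compose1[where g = "\<lambda>i. c (nat i)"], rule simple_function_finite_floor) auto
  show "AE t in lebesgue_on {0..real N * \<tau>}. ?s t = f t"
    using AE_in_open_step[OF tau, of N]
  proof (rule AE_mp, intro AE_I2 impI)
    fix t assume "\<exists>k<N. real k * \<tau> < t \<and> t < real (Suc k) * \<tau>"
    then obtain k where k: "k < N" "real k * \<tau> < t" "t < real (Suc k) * \<tau>" by blast
    then have "real k < (1 / \<tau>) * t" "(1 / \<tau>) * t < real k + 1" using tau by (auto simp: field_simps)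
    then have "nat \<lfloor>(1 / \<tau>) * t\<rfloor> = k" by linarith
    then show "?s t = f t" using step[OF k] by simp
  qed
qed

lemma strongly_measurable: "strongly_measurable (real N * \<tau>) nrm f"
proof -
  obtain s where s: "simple_function (lebesgue_on {0..real N * \<tau>}) s"
    "AE t in lebesgue_on {0..real N * \<tau>}. s t = f t" by (rule AE_eq_simple)
  show ?thesis
    unfolding strongly_measurable_def
  proof (intro exI[of _ "\<lambda>_. s"] conjI allI s(1))
    show "AE t in lebesgue_on {0..real N * \<tau>}. (\<lambda>n. nrm (s t - f t)) \<longlonglongrightarrow> 0"
      using s(2) by eventually_elim (simp add: nrm_0)
  qed
qed

lemma Linf_norm_le:
  assumes "\<And>k. k < N \<Longrightarrow> nrm (c k) \<le> C"
  shows "Linf_norm (real N * \<tau>) nrm f \<le> ennreal C"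
proof -
  obtain s where s: "simple_function (lebesgue_on {0..real N * \<tau>}) s"
    "AE t in lebesgue_on {0..real N * \<tau>}. s t = f t" by (rule AE_eq_simple)
  \<comment> \<open>The bound of \<open>esssup\<close> calls for measurability with an arbitrary
    \<open>nrm\<close>; it is inherited from \<open>s\<close>, since any function of a simple
    function is simple.\<close>
  have "(\<lambda>t. ennreal (nrm (f t))) \<in> borel_measurable (lebesgue_on {0..real N * \<tau>})"
  proof (rule measurable_lebesgue_on_AE_cong[of _ "\<lambda>t. ennreal (nrm (s t))"])
    show "(\<lambda>t. ennreal (nrm (s t))) \<in> borel_measurable (lebesgue_on {0..real N * \<tau>})"
      by (rule borel_measurable_simple_function, rule simple_function_compose1[OF s(1)])
    show "AE t in lebesgue_on {0..real N * \<tau>}. ennreal (nrm (s t)) = ennreal (nrm (f t))"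
      using s(2) by eventually_elim simp
  qed simp
  moreover have "AE t in lebesgue_on {0..real N * \<tau>}. ennreal (nrm (f t)) \<le> ennreal C"
    using AE_in_open_step[OF tau, of N] by eventually_elim (use assms step in \<open>auto intro!: ennreal_leI\<close>)
  ultimately show ?thesis
    unfolding Linf_norm_def using strongly_measurable by (auto intro: esssup_I)
qed

lemma Lp_norm_le:
  assumes p: "p > 0" and K: "(\<Sum>k<N. \<tau> * nrm (c k) powr p) \<le> K"
  shows "Lp_norm (real N * \<tau>) p nrm f \<le> ennreal (K powr (1 / p))"
proof -
  let ?M = "lebesgue_on {0..real N * \<tau>}"
  define I where "I = (\<integral>\<^sup>+ t. ennreal (nrm (f t) powr p) \<partial>?M)"
  let ?J = "\<lambda>k. {real k * \<tau><..<real (Suc k) * \<tau>}"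
  have sub: "?J k \<subseteq> {0..real N * \<tau>}" if "k \<in> {..<N}" for k
  proof -
    have "real (Suc k) * \<tau> \<le> real N * \<tau>" using that tau by (intro mult_right_mono) auto
    moreover have "0 \<le> real k * \<tau>" using tau by simp
    ultimately show ?thesis unfolding subset_iff greaterThanLessThan_iff atLeastAtMost_iff by linarith
  qed
  have J: "?J k \<in> sets ?M" if "k \<in> {..<N}" for k
    using sub[OF that] by (auto simp: sets_restrict_space_iff)
  have "I \<le> (\<integral>\<^sup>+ t. (\<Sum>k<N. ennreal (nrm (c k) powr p) * indicator (?J k) t) \<partial>?M)"
    unfolding I_def
  proof (rule nn_integral_mono_AE)
    show "AE t in ?M. ennreal (nrm (f t) powr p) \<le> (\<Sum>k<N. ennreal (nrm (c k) powr p) * indicator (?J k) t)"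
      using AE_in_open_step[OF tau, of N]
    proof eventually_elim
      case (elim t)
      then obtain k where k: "k < N" "real k * \<tau> < t" "t < real (Suc k) * \<tau>" by blast
      then have "ennreal (nrm (f t) powr p) = ennreal (nrm (c k) powr p) * indicator (?J k) t"
        using step by simp
      also have "\<dots> \<le> (\<Sum>k<N. ennreal (nrm (c k) powr p) * indicator (?J k) t)"
        using k by (intro member_le_sum) auto
      finally show ?case .
    qed
  qed
  also have "\<dots> = (\<Sum>k<N. \<integral>\<^sup>+ t. ennreal (nrm (c k) powr p) * indicator (?J k) t \<partial>?M)"
    by (intro nn_integral_sum borel_measurable_times_ennreal borel_measurable_indicator J) auto
  also have "\<dots> \<le> (\<Sum>k<N. ennreal (\<tau> * nrm (c k) powr p))"
  proof (intro sum_mono)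
    fix k assume k: "k \<in> {..<N}"
    have "emeasure ?M (?J k) = ennreal \<tau>"
      using sub[OF k] tau by (subst emeasure_restrict_space) (auto simp: algebra_simps)
    with J[OF k] have "(\<integral>\<^sup>+ t. ennreal (nrm (c k) powr p) * indicator (?J k) t \<partial>?M)
        = ennreal (nrm (c k) powr p) * ennreal \<tau>"
      by (subst nn_integral_cmult_indicator) auto
    then show "(\<integral>\<^sup>+ t. ennreal (nrm (c k) powr p) * indicator (?J k) t \<partial>?M) \<le> ennreal (\<tau> * nrm (c k) powr p)"
      using tau by (simp add: ennreal_mult'[symmetric] mult.commute)
  qed
  also have "\<dots> = ennreal (\<Sum>k<N. \<tau> * nrm (c k) powr p)"
    using tau by (intro sum_ennreal) auto
  also have "\<dots> \<le> ennreal K" using K by (intro ennreal_leI)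
  finally have I: "I \<le> ennreal K" .
  have "0 \<le> (\<Sum>k<N. \<tau> * nrm (c k) powr p)" using tau by (intro sum_nonneg) auto
  then have "K \<ge> 0" using K by simp
  have "I < top" using I by (metis ennreal_less_top order_le_less_trans)
  moreover have "enn2real I \<le> K" using I \<open>K \<ge> 0\<close> by (simp add: enn2real_leI)
  ultimately show ?thesis
    unfolding Lp_norm_def Let_def I_def[symmetric] using strongly_measurable p
    by (auto intro!: ennreal_leI powr_mono2)
qed

end

text \<open>The fundamental theorem of calculus of the library requires the class \<open>banach\<close>, which the sort
  \<open>{real_inner, complete_space}\<close> of the Hilbert space is not an instance of.\<close>

lemma time_deriv_affine_interp_has_integral:
  fixes w :: "nat \<Rightarrow> 'a::real_normed_vector"
  assumes tau: "\<tau> > 0" and t: "t \<in> {0..real N * \<tau>}"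
  shows "(time_deriv (affine_interp \<tau> w) has_integral affine_interp \<tau> w t - affine_interp \<tau> w 0) {0..t}"
  using t
proof (induction N arbitrary: t)
  case 0
  then show ?case by (auto intro: has_integral_refl(2)[of _ "0::real", simplified])
next
  case (Suc N)
  let ?w = "affine_interp \<tau> w" and ?s = "real N * \<tau>"
  have s: "0 \<le> ?s" using tau by simp
  show ?case
  proof (cases "t \<le> ?s")
    case True
    then show ?thesis using Suc by auto
  next
    case False
    let ?c = "(1 / \<tau>) *\<^sub>R (w (Suc N) - w N)"
    have t: "?s \<le> t" "t \<le> real (Suc N) * \<tau>" using False Suc.prems by auto
    have "((\<lambda>_. ?c) has_integral measure lborel {?s..t} *\<^sub>R ?c) (cbox ?s t)"
      using has_integral_const_real[of ?c ?s t] by simp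
    then have "(time_deriv ?w has_integral measure lborel {?s..t} *\<^sub>R ?c) (cbox ?s t)"
    proof (rule has_integral_spike_interior)
      fix y assume "y \<in> box ?s t"
      then have "?s < y" "y < real (Suc N) * \<tau>" using t(2) by (auto simp: box_real)
      then show "time_deriv ?w y = ?c" by (rule time_deriv_affine_interp(2)[OF tau])
    qed
    moreover have "measure lborel {?s..t} *\<^sub>R ?c = ?w t - ?w ?s"
      using affine_interp_eq[OF tau t, of w] affine_interp_eq[OF tau order_refl, of N w] t tau by simp
    ultimately have right: "(time_deriv ?w has_integral ?w t - ?w ?s) {?s..t}" by simp
    have left: "(time_deriv ?w has_integral ?w ?s - ?w 0) {0..?s}" using Suc.IH[of ?s] s by simp
    have "cbox 0 t \<inter> {y. y \<bullet> 1 \<le> ?s} = {0..?s}" "cbox 0 t \<inter> {y. y \<bullet> 1 \<ge> ?s} = {?s..t}"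
      using t s by auto
    then have "(time_deriv ?w has_integral (?w ?s - ?w 0) + (?w t - ?w ?s)) (cbox 0 t)"
      using left right by (intro has_integral_split[of _ _ 0 t 1 ?s]) auto
    then show ?thesis by simp
  qed
qed

lemma W1inf_norm_affine_interp_le:
  fixes w :: "nat \<Rightarrow> 'a::real_normed_vector"
  assumes tau: "\<tau> > 0" and w: "\<And>k. k \<le> N \<Longrightarrow> norm (w k) \<le> C"
    and dw: "\<And>k. k < N \<Longrightarrow> norm ((1 / \<tau>) *\<^sub>R (w (Suc k) - w k)) \<le> D"
  shows "W1inf_norm (real N * \<tau>) (affine_interp \<tau> w) \<le> ennreal C + ennreal D"
proof -
  let ?w = "affine_interp \<tau> w" and ?T = "real N * \<tau>"
  have "AE t in lebesgue_on {0..?T}. ?w differentiable at t"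
    using AE_in_open_step[OF tau, of N]
    by eventually_elim (use time_deriv_affine_interp(1)[OF tau] differentiableI_vector in blast)
  then have "integral_of_deriv ?T ?w"
    unfolding integral_of_deriv_def using time_deriv_affine_interp_has_integral[OF tau] by blast
  moreover have "Linf_norm ?T norm ?w \<le> ennreal C"
    using tau w by (rule Linf_norm_affine_interp_le)
  moreover have "Linf_norm ?T norm (time_deriv ?w) \<le> ennreal D"
  proof -
    interpret step_function \<tau> N norm "time_deriv ?w" "\<lambda>k. (1 / \<tau>) *\<^sub>R (w (Suc k) - w k)"
      by standard (simp_all only: tau norm_zero time_deriv_affine_interp(2))
    show ?thesis using dw by (rule Linf_norm_le)
  qed
  ultimately show ?thesis unfolding W1inf_norm_def by (auto intro: add_mono)
qed

section \<open>A Gronwall inequality and quadratic functionals\<close>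

text \<open>Otherwise R > 1, hence A + B * R <= (A + B) * R < R * R.\<close>

lemma sq_le_of_le_affine:
  fixes R A B :: real
  assumes "R\<^sup>2 \<le> A + B * R" "A \<ge> 0" "B \<ge> 0"
  shows "R \<le> 1 + A + B"
proof (rule ccontr)
  assume "\<not> R \<le> 1 + A + B"
  then have R: "1 + A + B < R" by simp
  then have "A + B * R \<le> A * R + B * R" using assms by (simp add: mult_left_mono[of 1 R A, simplified])
  also have "\<dots> < (1 + A + B) * R" using R assms by (simp add: algebra_simps)
  also have "\<dots> \<le> R * R" using R assms by (intro mult_right_mono) auto
  finally show False using assms by (simp add: power2_eq_square)
qed

text \<open>The square-root terms are estimated by their maximum \<open>R\<close> before iterating; the resulting inequality
  \<open>R\<^sup>2 \<le> A + B R\<close> bounds \<open>R\<close> although the weights \<open>g k\<close> need not be small.\<close>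

lemma discrete_gronwall_sqrt:
  fixes e P g :: "nat \<Rightarrow> real"
  assumes tau: "\<tau> \<ge> 0" "real N * \<tau> \<le> T" and a: "a \<ge> 0" and b: "b \<ge> 0"
    and e: "\<And>k. k < N \<Longrightarrow> e k \<ge> 0" and P: "\<And>k. P k \<ge> 0" and g: "\<And>k. g k \<ge> 0"
    and e0: "e 0 \<le> K" and G: "(\<Sum>k<N. g k) \<le> G"
    and step: "\<And>k. Suc k < N \<Longrightarrow>
      e (Suc k) + P (Suc k) \<le> (1 + \<tau> * a) * e k + \<tau> * b + g (Suc k) * (1 + sqrt (e k) + sqrt (e (Suc k)))"
    and C: "C = (1 + exp (a * T) * (\<bar>K\<bar> + b * T + G) + exp (a * T) * (2 * G))\<^sup>2"
    and n: "n < N"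
  shows "e n + (\<Sum>k=1..n. P k) \<le> C"
proof -
  define R where "R = Max ((\<lambda>k. sqrt (e k)) ` {..<N})"
  have N: "0 < N" using n by simp
  have R: "sqrt (e k) \<le> R" if "k < N" for k
    unfolding R_def using that by (intro Max_ge) auto
  have R0: "0 \<le> R" using R[OF N] e[OF N] by (meson order_trans real_sqrt_ge_zero)
  have G0: "0 \<le> G" using G g by (meson order_trans sum_nonneg)
  have T0: "0 \<le> T" using tau by (meson mult_nonneg_nonneg of_nat_0_le_iff order_trans)
  have K0: "0 \<le> K" using e0 e[OF N] by simp
  \<comment> \<open>The sum starts at 1 because the hypothesis on steps contains no
    \<open>P 0\<close>.\<close>
  have iter: "m < N \<Longrightarrow> e m + (\<Sum>k=1..m. P k) \<le>
      (1 + \<tau> * a) ^ m * (K + (\<Sum>k=1..m. \<tau> * b + g k * (1 + 2 * R)))" for m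
  proof (induction m)
    case 0
    then show ?case using e0 by simp
  next
    case (Suc m)
    let ?S = "\<lambda>m. \<Sum>k=1..m. \<tau> * b + g k * (1 + 2 * R)" and ?q = "1 + \<tau> * a"
    have q: "1 \<le> ?q" using tau a by simp
    have q': "1 \<le> ?q ^ Suc m" using q by (rule one_le_power)
    have x: "0 \<le> \<tau> * b + g (Suc m) * (1 + 2 * R)" using tau b g R0 by simp
    have "g (Suc m) * (1 + sqrt (e m) + sqrt (e (Suc m))) \<le> g (Suc m) * (1 + 2 * R)"
      using R[of m] R[of "Suc m"] Suc.prems g by (intro mult_left_mono) auto
    then have "e (Suc m) + (\<Sum>k=1..Suc m. P k)
        \<le> ?q * e m + (\<Sum>k=1..m. P k) + (\<tau> * b + g (Suc m) * (1 + 2 * R))"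
      using step[OF Suc.prems] by simp
    also have "\<dots> \<le> ?q * (e m + (\<Sum>k=1..m. P k)) + ?q ^ Suc m * (\<tau> * b + g (Suc m) * (1 + 2 * R))"
    proof -
      have "0 \<le> \<tau> * a * (\<Sum>k=1..m. P k)" using tau a P by (simp add: sum_nonneg)
      then have "?q * e m + (\<Sum>k=1..m. P k) \<le> ?q * (e m + (\<Sum>k=1..m. P k))" by (simp add: algebra_simps)
      then show ?thesis using mult_right_mono[OF q' x] by simp
    qed
    also have "\<dots> \<le> ?q * (?q ^ m * (K + ?S m)) + ?q ^ Suc m * (\<tau> * b + g (Suc m) * (1 + 2 * R))"
      using Suc q by (intro add_right_mono mult_left_mono) auto
    also have "\<dots> = ?q ^ Suc m * (K + ?S (Suc m))" by (simp add: algebra_simps)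
    finally show ?case .
  qed
  define A where "A = exp (a * T) * (K + b * T + G)"
  define B where "B = exp (a * T) * (2 * G)"
  have A0: "0 \<le> A" and B0: "0 \<le> B" unfolding A_def B_def using K0 b T0 G0 by auto
  have bound: "e m + (\<Sum>k=1..m. P k) \<le> A + B * R" if "m < N" for m
  proof -
    have "(1 + \<tau> * a) ^ m \<le> exp (\<tau> * a) ^ m"
      using tau a by (intro power_mono) auto
    also have "\<dots> = exp (a * (real m * \<tau>))" by (simp add: exp_of_nat_mult[symmetric] algebra_simps)
    also have "\<dots> \<le> exp (a * T)"
    proof -
      have "real m * \<tau> \<le> real N * \<tau>" using that tau by (intro mult_right_mono) auto
      then show ?thesis using tau a by (simp add: mult_left_mono)
    qed
    finally have pw: "(1 + \<tau> * a) ^ m \<le> exp (a * T)" .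
    have sub: "(\<Sum>k=1..m. g k) \<le> G"
    proof -
      have "(\<Sum>k=1..m. g k) \<le> (\<Sum>k<N. g k)" using that g by (intro sum_mono2) auto
      then show ?thesis using G by simp
    qed
    have "(\<Sum>k=1..m. \<tau> * b + g k * (1 + 2 * R)) = (real m * \<tau>) * b + (\<Sum>k=1..m. g k) * (1 + 2 * R)"
      by (simp add: sum.distrib sum_distrib_right)
    also have "\<dots> \<le> b * T + G * (1 + 2 * R)"
    proof -
      have "real m * \<tau> \<le> real N * \<tau>" using that tau by (intro mult_right_mono) auto
      then have "(real m * \<tau>) * b \<le> T * b" using tau b by (intro mult_right_mono) auto
      moreover have "(\<Sum>k=1..m. g k) * (1 + 2 * R) \<le> G * (1 + 2 * R)" using sub R0 by (intro mult_right_mono) auto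
      ultimately show ?thesis by (simp add: mult.commute)
    qed
    finally have S: "(\<Sum>k=1..m. \<tau> * b + g k * (1 + 2 * R)) \<le> b * T + G * (1 + 2 * R)" .
    have S0: "0 \<le> (\<Sum>k=1..m. \<tau> * b + g k * (1 + 2 * R))"
      using tau b g R0 by (intro sum_nonneg) auto
    have "e m + (\<Sum>k=1..m. P k) \<le> (1 + \<tau> * a) ^ m * (K + (\<Sum>k=1..m. \<tau> * b + g k * (1 + 2 * R)))"
      using iter that by blast
    also have "\<dots> \<le> exp (a * T) * (K + (b * T + G * (1 + 2 * R)))"
      using pw S S0 K0 by (intro mult_mono) auto
    also have "\<dots> = A + B * R" by (simp add: A_def B_def algebra_simps)
    finally show ?thesis .
  qed
  have "R \<in> (\<lambda>k. sqrt (e k)) ` {..<N}" unfolding R_def using N by (intro Max_in) auto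
  then obtain m where m: "m < N" "R = sqrt (e m)" by auto
  have "R\<^sup>2 = e m" using m e by simp
  also have "\<dots> \<le> e m + (\<Sum>k=1..m. P k)" using P by (simp add: sum_nonneg)
  also have "\<dots> \<le> A + B * R" using bound m by blast
  finally have "R \<le> 1 + A + B" using A0 B0 by (rule sq_le_of_le_affine)
  have "e n + (\<Sum>k=1..n. P k) \<le> A + B * R" using bound n by blast
  also have "\<dots> \<le> A + B * (1 + A + B)" using \<open>R \<le> 1 + A + B\<close> B0 by (intro add_left_mono mult_left_mono)
  also have "\<dots> \<le> (1 + A + B)\<^sup>2"
    using A0 B0 by (simp add: power2_eq_square algebra_simps)
  finally show ?thesis using C K0 by (simp add: A_def B_def)
qed

text \<open>Along d the difference quotient is affine in r with slope \<open>B d d\<close>. As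
  \<open>B\<close> need not be symmetric, both mixed terms survive.\<close>

lemma gateaux_quadratic:
  assumes B: "bounded_bilinear B" and L: "bounded_linear L" and f: "\<And>x. f x = B x x + L x + c"
    and D: "has_gateaux_derivative f D x"
  shows "blinfun_apply D d = B x d + B d x + L d"
proof -
  interpret B: bounded_bilinear B by fact
  interpret L: bounded_linear L by fact
  have "((\<lambda>r. (f (x + r *\<^sub>R d) - f x) / r) \<longlongrightarrow> blinfun_apply D d) (at 0)"
    using D unfolding has_gateaux_derivative_def by blast
  moreover have "((\<lambda>r. (f (x + r *\<^sub>R d) - f x) / r) \<longlongrightarrow> B x d + B d x + L d) (at 0)"
  proof (rule Lim_transform_eventually)
    have "((\<lambda>r. B x d + B d x + r * B d d + L d) \<longlongrightarrow> B x d + B d x + 0 * B d d + L d) (at 0)"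
      by (intro tendsto_intros)
    then show "((\<lambda>r. B x d + B d x + r * B d d + L d) \<longlongrightarrow> B x d + B d x + L d) (at 0)" by simp
    show "\<forall>\<^sub>F r in at 0. B x d + B d x + r * B d d + L d = (f (x + r *\<^sub>R d) - f x) / r"
      by (auto simp: eventually_at_filter f B.add_left B.add_right B.scaleR_left B.scaleR_right
          L.add L.scaleR field_simps)
  qed
  ultimately show ?thesis by (rule tendsto_unique[rotated]) simp
qed

text \<open>The derivative is affine in its base point, so the trapezoidal and the midpoint rule are
  exact. The former suits the stress, which enters at both ends of a step, the latter the flow
  rule.\<close>

lemma quadratic_increment:
  assumes q: "quadratic_fun f" and D: "\<And>x. has_gateaux_derivative f (D x) x"
  shows "f y - f x = (1 / 2) * (blinfun_apply (D x) (y - x) + blinfun_apply (D y) (y - x))"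
    and "f y - f x = blinfun_apply (D ((1 / 2) *\<^sub>R (y + x))) (y - x)"
proof -
  obtain B L c where B: "bounded_bilinear B" and L: "bounded_linear L" and f: "\<And>x. f x = B x x + L x + c"
    using q unfolding quadratic_fun_def by blast
  interpret B: bounded_bilinear B by fact
  interpret L: bounded_linear L by fact
  have d: "blinfun_apply (D x) d = B x d + B d x + L d" for x d
    by (rule gateaux_quadratic[OF B L f D])
  show "f y - f x = (1 / 2) * (blinfun_apply (D x) (y - x) + blinfun_apply (D y) (y - x))"
    by (simp add: d f B.diff_left B.diff_right L.diff field_simps)
  show "f y - f x = blinfun_apply (D ((1 / 2) *\<^sub>R (y + x))) (y - x)"
    by (simp add: d f B.diff_left B.diff_right B.add_left B.add_right B.scaleR_left B.scaleR_right
        L.diff L.add field_simps)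
qed

text \<open>Serves to bound the stored energy at zero \<open>\<Sigma>\<close> uniformly over the
  initial values of z; the bound becomes \<open>K\<^sub>\<Phi>\<close>.\<close>

lemma quadratic_bounded_on_ball:
  assumes "quadratic_fun f"
  obtains K where "\<And>x. norm x \<le> r \<Longrightarrow> f x \<le> K"
proof -
  obtain B L c where B: "bounded_bilinear B" and L: "bounded_linear L" and f: "\<And>x. f x = B x x + L x + c"
    using assms unfolding quadratic_fun_def by blast
  obtain b where b: "b \<ge> 0" "\<And>x y. norm (B x y) \<le> norm x * norm y * b"
    using bounded_bilinear.nonneg_bounded[OF B] by blast
  obtain l where l: "l \<ge> 0" "\<And>x. norm (L x) \<le> norm x * l"
    using bounded_linear.nonneg_bounded[OF L] by blast
  have "f x \<le> r * r * b + r * l + c" if "norm x \<le> r" for x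
  proof -
    have "0 \<le> r" using that norm_ge_zero order_trans by blast
    then have "norm x * norm x * b \<le> r * r * b" "norm x * l \<le> r * l"
      using that b l by (auto intro!: mult_mono)
    then show ?thesis using b(2)[of x x] l(2)[of x] by (simp add: f)
  qed
  then show ?thesis by (rule that)
qed

section \<open>The discrete energy estimate\<close>

text \<open>\<open>M\<close> is a common bound of all data that vary with \<open>\<tau>\<close> and \<open>h\<close>, so that every constant defined in this
  locale is independent of \<open>\<tau>\<close> and \<open>h\<close>.\<close>

locale energy_data =
  fixes \<iota> :: "'z::real_normed_vector \<Rightarrow> 'z1::real_normed_vector"
    and Tk :: "'h::real_inner \<Rightarrow> real" and Tk' :: "'h \<Rightarrow>\<^sub>L 'h dual"
    and \<Phi> :: "'s::real_normed_vector \<Rightarrow> 'z \<Rightarrow> real"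
    and \<Phi>S :: "'s \<Rightarrow> 'z \<Rightarrow> 's dual" and \<Phi>Z :: "'s \<Rightarrow> 'z \<Rightarrow> 'z dual"
    and \<Psi> :: "'z \<Rightarrow> ereal"
    and \<epsilon> p C0 L T M K\<^sub>\<Phi> :: real
  assumes iota: "bounded_linear \<iota>"
    and Tk: "\<And>v. Tk v = (1 / 2) * blinfun_apply (blinfun_apply Tk' v) v"
            "\<And>v. has_gateaux_derivative Tk (blinfun_apply Tk' v) v"
    and Phi_quadratic: "\<And>z. quadratic_fun (\<lambda>\<sigma>. \<Phi> \<sigma> z)" "\<And>\<sigma>. quadratic_fun (\<Phi> \<sigma>)"
    and Phi_derivs: "\<And>\<sigma> z. has_gateaux_derivative (\<lambda>s. \<Phi> s z) (\<Phi>S \<sigma> z) \<sigma>"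
                    "\<And>\<sigma> z. has_gateaux_derivative (\<Phi> \<sigma>) (\<Phi>Z \<sigma> z) z"
    and Psi: "\<Psi> 0 \<ge> 0" "\<Psi> 0 < \<infinity>"
    and eps: "\<epsilon> > 0" and p: "p \<ge> 2"
    and Tk_coercive: "\<And>v. Tk v \<ge> \<epsilon> * (norm v)\<^sup>2"
    and Phi_coercive: "\<And>\<sigma> z. \<Phi> \<sigma> z \<ge> \<epsilon> * (norm \<sigma>)\<^sup>2 + \<epsilon> * (norm z)\<^sup>2"
    and Psi_coercive: "\<And>z. \<Psi> z \<ge> ereal (\<epsilon> * norm (\<iota> z) powr p)"
    and PhiS_growth: "\<And>\<sigma> z. norm (\<Phi>S \<sigma> z) \<le> C0 * (1 + norm \<sigma> + norm z)"
    and PhiS_lipschitz: "\<And>\<sigma> z z'. norm (\<Phi>S \<sigma> z - \<Phi>S \<sigma> z') \<le> L * norm (\<iota> (z - z'))"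
    and T: "T > 0" and M: "M \<ge> 0"
    and Phi_0_le: "\<And>z. norm z \<le> M \<Longrightarrow> \<Phi> 0 z \<le> K\<^sub>\<Phi>"
begin

text \<open>\<open>c\<^sub>a\<close> controls the acceleration; \<open>r\<^sub>\<Sigma>\<close>, \<open>r\<^sub>\<Phi>\<close>, \<open>r\<^sub>v\<close> and \<open>e\<^sub>0\<close> bound \<open>\<Sigma>\<^sup>1\<close>, the stored energy after the first
  step, \<open>v\<^sup>1\<close> and the initial energy; \<open>c\<^sub>1\<close>, \<open>c\<^sub>2\<close>, \<open>c\<^sub>D\<close> are the coefficients of the Gronwall inequality.\<close>

definition "\<Psi>\<^sub>0 = real_of_ereal (\<Psi> 0)"
definition "c\<^sub>a = M * (1 + \<bar>C0\<bar>) / (2 * \<epsilon>)"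
definition "r\<^sub>\<Sigma> = 2 * M + T * M\<^sup>2"
definition "r\<^sub>\<Phi> = K\<^sub>\<Phi> + \<bar>C0\<bar> * (1 + r\<^sub>\<Sigma> + M) * r\<^sub>\<Sigma> + T * \<Psi>\<^sub>0"
definition "r\<^sub>v = M + T * (c\<^sub>a * (1 + 2 * sqrt (r\<^sub>\<Phi> / \<epsilon>)))"
definition "e\<^sub>0 = (1 / 2) * (norm Tk' * r\<^sub>v * M) + r\<^sub>\<Phi> + \<epsilon> / 2"
definition "c\<^sub>1 = 2 / \<epsilon> * (M + (L * M)\<^sup>2 * T\<^sup>2 / (4 * \<epsilon>))"
definition "c\<^sub>2 = \<Psi>\<^sub>0 + \<epsilon> / 2 + (L * M)\<^sup>2 / (4 * \<epsilon>) + M"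
definition "c\<^sub>D = 2 * \<bar>C0\<bar> * (1 + sqrt (2 / \<epsilon>))"
text \<open>The bound of \<open>discrete_gronwall_sqrt\<close> for growth rate
  \<open>c\<^sub>1\<close>, source \<open>c\<^sub>2\<close> and weights
  \<open>c\<^sub>D * (\<tau> * norm (D k))\<close>, whose total is at most
  \<open>c\<^sub>D * M\<close>.\<close>

definition "e_bound = (1 + exp (c\<^sub>1 * T) * (\<bar>e\<^sub>0\<bar> + c\<^sub>2 * T + c\<^sub>D * M) + exp (c\<^sub>1 * T) * (2 * (c\<^sub>D * M)))\<^sup>2"
text \<open>\<open>M\<close> covers level 0, for which the energy gives no bound; the root inverts
  the coercivity of the energy with factor \<open>\<epsilon> / 2\<close>.\<close>

definition "state_bound = M + sqrt (2 * e_bound / \<epsilon>)"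

section \<open>Direct consequences of the structural assumptions\<close>

lemma Psi_0: "\<Psi> 0 = ereal \<Psi>\<^sub>0" "\<Psi>\<^sub>0 \<ge> 0"
  using Psi unfolding \<Psi>\<^sub>0_def by (cases "\<Psi> 0"; simp)+

text \<open>The Gateaux derivative of the quadratic form of \<open>Tk'\<close> is the symmetrised
  operator; it is assumed to be \<open>Tk'\<close> itself.\<close>

lemma Tk'_sym: "blinfun_apply (blinfun_apply Tk' v) w = blinfun_apply (blinfun_apply Tk' w) v"
proof -
  have B: "bounded_bilinear (\<lambda>v. blinfun_apply (blinfun_apply ((1 / 2) *\<^sub>R Tk') v))"
    by (intro bounded_bilinear.comp1[OF bounded_bilinear_blinfun_apply] blinfun.bounded_linear_right)
  show ?thesis
    using gateaux_quadratic[OF B bounded_linear_zero, of Tk 0 "blinfun_apply Tk' v" v w] Tk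
    by (simp add: blinfun.scaleR_left)
qed

lemma Tk'_coercive: "2 * \<epsilon> * (norm v)\<^sup>2 \<le> blinfun_apply (blinfun_apply Tk' v) v"
  using Tk_coercive[of v] Tk(1)[of v] by simp

lemma Tk'_bound: "\<bar>blinfun_apply (blinfun_apply Tk' v) w\<bar> \<le> norm Tk' * norm v * norm w"
  using norm_blinfun[of "blinfun_apply Tk' v" w] norm_blinfun[of Tk' v]
  by (simp add: order_trans[OF _ mult_right_mono])

lemma PhiS_le: "norm (\<Phi>S \<sigma> z) \<le> \<bar>C0\<bar> * (1 + norm \<sigma> + norm z)"
proof -
  have "C0 * (1 + norm \<sigma> + norm z) \<le> \<bar>C0\<bar> * (1 + norm \<sigma> + norm z)" by (intro mult_right_mono) auto
  then show ?thesis using PhiS_growth[of \<sigma> z] by linarith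
qed

lemma Phi_nonneg: "\<Phi> \<sigma> z \<ge> 0"
proof -
  have "0 \<le> \<epsilon> * (norm \<sigma>)\<^sup>2 + \<epsilon> * (norm z)\<^sup>2" using eps by simp
  then show ?thesis using Phi_coercive[of \<sigma> z] by linarith
qed

lemma K_Phi_nonneg: "K\<^sub>\<Phi> \<ge> 0"
  using Phi_0_le[of 0] Phi_nonneg[of 0 0] M by simp

lemma constants_nonneg: "c\<^sub>a \<ge> 0" "r\<^sub>\<Sigma> \<ge> 0" "r\<^sub>\<Phi> \<ge> 0" "r\<^sub>v \<ge> 0" "c\<^sub>1 \<ge> 0" "c\<^sub>2 \<ge> 0" "c\<^sub>D \<ge> 0" "e_bound \<ge> 0" "state_bound \<ge> M"
proof -
  show a: "c\<^sub>a \<ge> 0" "r\<^sub>\<Sigma> \<ge> 0" unfolding c\<^sub>a_def r\<^sub>\<Sigma>_def using M T eps by auto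
  then show P: "r\<^sub>\<Phi> \<ge> 0" unfolding r\<^sub>\<Phi>_def using K_Phi_nonneg M T Psi_0(2) by (intro add_nonneg_nonneg mult_nonneg_nonneg) auto
  show "r\<^sub>v \<ge> 0" unfolding r\<^sub>v_def using a P M T eps by (intro add_nonneg_nonneg mult_nonneg_nonneg) auto
  show "c\<^sub>1 \<ge> 0" unfolding c\<^sub>1_def using M eps by simp
  show "c\<^sub>2 \<ge> 0" unfolding c\<^sub>2_def using M eps Psi_0(2) by simp
  show "c\<^sub>D \<ge> 0" unfolding c\<^sub>D_def using eps by simp
  show "e_bound \<ge> 0" unfolding e_bound_def by simp
  then show "state_bound \<ge> M" unfolding state_bound_def using eps by simp
qed

text \<open>This is where \<open>p \<ge> 2\<close> enters: the quadratic term from Young's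
  inequality is absorbed in a dissipation of order p, with 1 covering small arguments.\<close>

lemma powr_bound: "x\<^sup>2 \<le> 1 + x powr p" if "x \<ge> 0"
proof (cases "x \<le> 1")
  case True
  then have "x\<^sup>2 \<le> 1" using that by (simp add: power_le_one)
  then show ?thesis by (simp add: add_increasing2)
next
  case False
  then have "x powr 2 \<le> x powr p" using p by (intro powr_mono) auto
  then show ?thesis using False by (simp add: powr_numeral)
qed

end

text \<open>\<open>A\<close> stands for \<open>\<CC>E\<^sub>h\<close> and \<open>D\<close> for the load rate; of the flow rule only the test by \<open>0\<close> is kept.\<close>

locale staggered_run = energy_data \<iota> Tk Tk' \<Phi> \<Phi>S \<Phi>Z \<Psi> \<epsilon> p C0 L T M K\<^sub>\<Phi>
  for \<iota> :: "'z::real_normed_vector \<Rightarrow> 'z1::real_normed_vector"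
    and Tk :: "'h::real_inner \<Rightarrow> real" and Tk' :: "'h \<Rightarrow>\<^sub>L 'h dual"
    and \<Phi> :: "'s::real_normed_vector \<Rightarrow> 'z \<Rightarrow> real"
    and \<Phi>S :: "'s \<Rightarrow> 'z \<Rightarrow> 's dual" and \<Phi>Z :: "'s \<Rightarrow> 'z \<Rightarrow> 'z dual"
    and \<Psi> :: "'z \<Rightarrow> ereal"
    and \<epsilon> p C0 L T M K\<^sub>\<Phi> :: real +
  fixes \<tau> :: real and N :: nat and V :: "'h set" and A :: "'h \<Rightarrow>\<^sub>L 's" and f :: "'h dual"
    and D :: "nat \<Rightarrow> 's" and u :: "nat \<Rightarrow> 'h" and \<Sigma> :: "nat \<Rightarrow> 's" and v :: "nat \<Rightarrow> 'h" and z :: "nat \<Rightarrow> 'z"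
  assumes tau: "\<tau> > 0" and N: "N > 0" "real N * \<tau> = T" and small: "\<tau> * (norm Tk' * c\<^sub>a) \<le> \<epsilon>"
    and A_le: "norm A \<le> M" and f_le: "norm f \<le> M" and D_le: "(\<Sum>k<N. \<tau> * norm (D k)) \<le> M"
    and init: "norm (u 0) \<le> M" "norm (\<Sigma> 0) \<le> M" "norm (v 0) \<le> M" "norm (z 0) \<le> M"
    and V: "subspace V" and v_in: "\<And>k. k \<le> N \<Longrightarrow> v k \<in> V"
    and stress: "\<And>k. k < N \<Longrightarrow> \<Sigma> (Suc k) - \<Sigma> k = \<tau> *\<^sub>R (blinfun_apply A (v k) + D k)"
    and flow: "\<And>k. k < N \<Longrightarrow> \<Psi> ((1 / \<tau>) *\<^sub>R (z (Suc k) - z k)) \<le>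
       \<Psi> 0 + ereal (blinfun_apply (\<Phi>Z (\<Sigma> (Suc k)) ((1 / 2) *\<^sub>R (z (Suc k) + z k))) (0 - (1 / \<tau>) *\<^sub>R (z (Suc k) - z k)))"
    and momentum: "\<And>k w. k < N \<Longrightarrow> w \<in> V \<Longrightarrow>
       blinfun_apply (blinfun_apply Tk' ((1 / \<tau>) *\<^sub>R (v (Suc k) - v k))) w
       + blinfun_apply (\<Phi>S (\<Sigma> (Suc k)) (z (Suc k))) (blinfun_apply A w) = blinfun_apply f w"
    and displacement: "\<And>k. k < N \<Longrightarrow> u (Suc k) = u k + \<tau> *\<^sub>R v (Suc k)"
begin

abbreviation "\<delta> k \<equiv> (1 / \<tau>) *\<^sub>R (v (Suc k) - v k)"
abbreviation "x k \<equiv> norm (\<iota> ((1 / \<tau>) *\<^sub>R (z (Suc k) - z k)))"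

text \<open>The summand \<open>\<epsilon> / 2\<close> makes the energy nonnegative.\<close>

definition "e k = (1 / 2) * blinfun_apply (blinfun_apply Tk' (v (Suc k))) (v k)
  + \<Phi> (\<Sigma> (Suc k)) (z (Suc k)) + \<epsilon> / 2"
definition "Y k = (norm (v k))\<^sup>2 + (norm (\<Sigma> k))\<^sup>2 + (norm (z k))\<^sup>2"

section \<open>Estimates for single time steps\<close>

lemma tau_le_T: "\<tau> \<le> T"
proof -
  have "1 * \<tau> \<le> real N * \<tau>" using N(1) tau by (intro mult_right_mono) auto
  then show ?thesis using N by simp
qed

lemma tau_D_le: "k < N \<Longrightarrow> \<tau> * norm (D k) \<le> M"
  using D_le tau member_le_sum[of k "{..<N}" "\<lambda>k. \<tau> * norm (D k)"] by auto

lemma acceleration_le: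
  assumes "k < N"
  shows "norm (\<delta> k) \<le> c\<^sub>a * (1 + norm (\<Sigma> (Suc k)) + norm (z (Suc k)))"
proof (cases "\<delta> k = 0")
  case True
  show ?thesis unfolding True using constants_nonneg(1) by simp
next
  case False
  let ?d = "\<delta> k" and ?S = "\<Phi>S (\<Sigma> (Suc k)) (z (Suc k))" and ?s = "1 + norm (\<Sigma> (Suc k)) + norm (z (Suc k))"
  \<comment> \<open>The acceleration is an admissible test because the subspace \<open>V\<close>
    also contains the initial velocity.\<close>
  have "?d \<in> V" using V v_in assms by (intro subspace_scale subspace_diff) auto
  then have "2 * \<epsilon> * (norm ?d)\<^sup>2 \<le> blinfun_apply f ?d - blinfun_apply ?S (blinfun_apply A ?d)"
    using momentum[OF assms, of ?d] Tk'_coercive[of ?d] by linarith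
  also have "\<dots> \<le> norm f * norm ?d + norm ?S * (norm A * norm ?d)"
    using norm_blinfun[of f ?d] norm_blinfun[of ?S "blinfun_apply A ?d"]
      mult_left_mono[OF norm_blinfun[of A ?d] norm_ge_zero[of ?S]] by simp
  \<comment> \<open>The 1 in \<open>?s\<close> lets the force share the factor of the stress term;
    dividing \<open>M * (1 + \<bar>C0\<bar>)\<close> by \<open>2 * \<epsilon>\<close> gives
    \<open>c\<^sub>a\<close>.\<close>
  also have "\<dots> \<le> (M * ?s) * norm ?d + (\<bar>C0\<bar> * ?s) * (M * norm ?d)"
  proof (intro add_mono mult_mono PhiS_le A_le)
    have "norm f \<le> M * 1" using f_le by simp
    also have "\<dots> \<le> M * ?s" using M by (intro mult_left_mono) auto
    finally show "norm f \<le> M * ?s" .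
  qed (use M in auto)
  also have "\<dots> = (2 * \<epsilon> * (c\<^sub>a * ?s)) * norm ?d"
    using eps by (simp add: c\<^sub>a_def field_simps)
  finally have "(2 * \<epsilon> * norm ?d) * norm ?d \<le> (2 * \<epsilon> * (c\<^sub>a * ?s)) * norm ?d"
    by (simp only: power2_eq_square mult.assoc)
  then have "2 * \<epsilon> * norm ?d \<le> 2 * \<epsilon> * (c\<^sub>a * ?s)"
    by (rule mult_right_le_imp_le) (use False in \<open>simp only: zero_less_norm_iff not_False_eq_True\<close>)
  then show ?thesis by (rule mult_left_le_imp_le) (use eps in simp)
qed

text \<open>Replacing the old velocity by the new one minus \<tau> times the acceleration costs in
  the mixed product at most \<epsilon> times the sum of 1 and the three squared norms. Half of this
  enters the energy: \<open>\<epsilon> / 2\<close> of each square remains, and the shift in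
  \<open>e\<close> takes up the 1.\<close>

lemma energy_coercive:
  assumes "k < N"
  shows "\<epsilon> / 2 * Y (Suc k) \<le> e k"
proof -
  let ?a = "norm (v (Suc k))" and ?s = "norm (\<Sigma> (Suc k))" and ?r = "norm (z (Suc k))" and ?d = "norm (\<delta> k)"
  have "blinfun_apply (blinfun_apply Tk' (v (Suc k))) (v k)
      = blinfun_apply (blinfun_apply Tk' (v (Suc k))) (v (Suc k)) - \<tau> * blinfun_apply (blinfun_apply Tk' (v (Suc k))) (\<delta> k)"
    using tau by (simp add: blinfun.diff_right blinfun.scaleR_right)
  moreover have "\<tau> * blinfun_apply (blinfun_apply Tk' (v (Suc k))) (\<delta> k) \<le> \<tau> * (norm Tk' * ?a * ?d)"
    using Tk'_bound[of "v (Suc k)" "\<delta> k"] tau by (intro mult_left_mono) auto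
  ultimately have 1: "blinfun_apply (blinfun_apply Tk' (v (Suc k))) (v k) \<ge> 2 * \<epsilon> * ?a\<^sup>2 - \<tau> * (norm Tk' * ?a * ?d)"
    using Tk'_coercive[of "v (Suc k)"] by linarith
  have "\<tau> * (norm Tk' * ?a * ?d) \<le> \<tau> * (norm Tk' * ?a * (c\<^sub>a * (1 + ?s + ?r)))"
    using tau acceleration_le[OF assms] by (intro mult_left_mono) auto
  also have "\<dots> = (\<tau> * (norm Tk' * c\<^sub>a)) * (?a * (1 + ?s + ?r))" by simp
  also have "\<dots> \<le> \<epsilon> * (?a * (1 + ?s + ?r))" using small by (intro mult_right_mono) auto
  also have "\<dots> \<le> \<epsilon> * (?a\<^sup>2 + 1 + ?s\<^sup>2 + ?r\<^sup>2)"
  proof (intro mult_left_mono)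
    \<comment> \<open>Each of the three products takes 1/4 of the square of \<open>?a\<close>, so
      3/4 of it suffices.\<close>
    have "0 \<le> (?a / 2 - 1)\<^sup>2 + (?a / 2 - ?s)\<^sup>2 + (?a / 2 - ?r)\<^sup>2" by simp
    also have "\<dots> = 3 / 4 * ?a\<^sup>2 + 1 + ?s\<^sup>2 + ?r\<^sup>2 - ?a * (1 + ?s + ?r)"
      by (simp add: power2_eq_square field_simps)
    finally show "?a * (1 + ?s + ?r) \<le> ?a\<^sup>2 + 1 + ?s\<^sup>2 + ?r\<^sup>2"
      using zero_le_power2[of ?a] by linarith
  qed (use eps in auto)
  finally show ?thesis
    using 1 Phi_coercive[of "\<Sigma> (Suc k)" "z (Suc k)"] unfolding e_def Y_def by (simp add: algebra_simps)
qed

lemma Y_nonneg: "Y k \<ge> 0" by (simp add: Y_def)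

lemma energy_nonneg: "k < N \<Longrightarrow> e k \<ge> 0"
  using energy_coercive[of k] Y_nonneg[of "Suc k"] eps
  by (meson divide_nonneg_pos less_imp_le mult_nonneg_nonneg order_trans zero_less_numeral)

lemma Y_le: "k < N \<Longrightarrow> Y (Suc k) \<le> 2 / \<epsilon> * e k"
  using energy_coercive[of k] eps by (simp add: field_simps)

lemma norm_le_sqrt_Y: "norm (v k) \<le> sqrt (Y k)" "norm (\<Sigma> k) \<le> sqrt (Y k)" "norm (z k) \<le> sqrt (Y k)"
  unfolding Y_def by (rule real_le_rsqrt; simp)+

text \<open>Shaped so that the bounds at two consecutive levels add up to
  \<open>c\<^sub>D * (1 + sqrt (e k) + sqrt (e (Suc k)))\<close>, as in
  \<open>discrete_gronwall_sqrt\<close>.\<close>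

lemma PhiS_le_energy:
  assumes "k < N"
  shows "norm (\<Phi>S (\<Sigma> (Suc k)) (z (Suc k))) \<le> c\<^sub>D * (1 + 2 * sqrt (e k)) / 2"
proof -
  let ?q = "sqrt (2 / \<epsilon>)"
  have q: "0 \<le> ?q" using eps by simp
  have "sqrt (Y (Suc k)) \<le> ?q * sqrt (e k)"
    using Y_le[OF assms] by (metis real_sqrt_le_mono real_sqrt_mult)
  then have "1 + norm (\<Sigma> (Suc k)) + norm (z (Suc k)) \<le> 1 + 2 * (?q * sqrt (e k))"
    using norm_le_sqrt_Y(2,3)[of "Suc k"] by linarith
  also have "\<dots> \<le> (1 + ?q) * (1 + 2 * sqrt (e k))"
    using q energy_nonneg[OF assms] by (simp add: algebra_simps)
  finally have "\<bar>C0\<bar> * (1 + norm (\<Sigma> (Suc k)) + norm (z (Suc k))) \<le> \<bar>C0\<bar> * ((1 + ?q) * (1 + 2 * sqrt (e k)))"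
    by (intro mult_left_mono) auto
  then show ?thesis using PhiS_le[of "\<Sigma> (Suc k)" "z (Suc k)"] by (simp add: c\<^sub>D_def)
qed

text \<open>With the new \<open>\<Sigma>\<close> frozen, the midpoint in the flow rule makes the
  power of \<open>\<Phi>Z\<close> an exact increment in z. The term with
  \<open>\<Psi>\<^sub>0\<close> appears because \<Psi> need not vanish at 0.\<close>

lemma flow_energy:
  assumes "k < N"
  shows "\<Phi> (\<Sigma> (Suc k)) (z (Suc k)) + \<tau> * (\<epsilon> * x k powr p) \<le> \<Phi> (\<Sigma> (Suc k)) (z k) + \<tau> * \<Psi>\<^sub>0"
proof -
  let ?w = "(1 / \<tau>) *\<^sub>R (z (Suc k) - z k)"
  let ?D = "\<Phi>Z (\<Sigma> (Suc k)) ((1 / 2) *\<^sub>R (z (Suc k) + z k))"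
  have "ereal (\<epsilon> * x k powr p) \<le> \<Psi> 0 + ereal (blinfun_apply ?D (0 - ?w))"
    using order_trans[OF Psi_coercive flow[OF assms]] .
  then have "\<epsilon> * x k powr p \<le> \<Psi>\<^sub>0 - blinfun_apply ?D ?w"
    by (simp add: Psi_0 blinfun.minus_right)
  then have "\<tau> * (\<epsilon> * x k powr p) \<le> \<tau> * (\<Psi>\<^sub>0 - blinfun_apply ?D ?w)"
    using tau by (intro mult_left_mono) auto
  also have "\<dots> = \<tau> * \<Psi>\<^sub>0 - blinfun_apply ?D (z (Suc k) - z k)"
    using tau by (simp add: right_diff_distrib blinfun.scaleR_right del: scaleR_right_diff_distrib)
  finally show ?thesis
    using quadratic_increment(2)[OF Phi_quadratic(2) Phi_derivs(2), of "\<Sigma> (Suc k)" "z (Suc k)" "z k"] by simp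
qed

text \<open>By symmetry of \<open>Tk'\<close>, the difference of velocities across two steps, tested
  by \<open>v j\<close>, is an increment of mixed products. The stresses of both levels then work on
  the same increment of \<open>\<Sigma>\<close>; the trapezoidal rule wants the later one at the old
  z, and the last term is this discrepancy.\<close>

lemma energy_balance:
  assumes "Suc k < N"
  defines "j \<equiv> Suc k"
  shows "e j + \<tau> * (\<epsilon> * x j powr p) \<le> e k + \<tau> * blinfun_apply f (v j) + \<tau> * \<Psi>\<^sub>0
    + \<tau> / 2 * blinfun_apply (\<Phi>S (\<Sigma> (Suc j)) (z (Suc j)) + \<Phi>S (\<Sigma> j) (z j)) (D j)
    + (1 / 2) * blinfun_apply (\<Phi>S (\<Sigma> (Suc j)) (z j) - \<Phi>S (\<Sigma> (Suc j)) (z (Suc j))) (\<Sigma> (Suc j) - \<Sigma> j)"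
proof -
  have j: "j < N" "k < N" using assms by auto
  let ?T = "\<lambda>v w. blinfun_apply (blinfun_apply Tk' v) w"
  let ?Sn = "\<Phi>S (\<Sigma> (Suc j)) (z (Suc j))" and ?Sj = "\<Phi>S (\<Sigma> j) (z j)" and ?Sm = "\<Phi>S (\<Sigma> (Suc j)) (z j)"
  let ?d = "\<Sigma> (Suc j) - \<Sigma> j"
  have vj: "v j \<in> V" using v_in j by simp
  \<comment> \<open>The scheme advances \<open>\<Sigma>\<close> from j to \<open>Suc j\<close> with
    \<open>v j\<close>, so this test function yields that very increment, up to the load.\<close>
  have Av: "\<tau> *\<^sub>R blinfun_apply A (v j) = ?d - \<tau> *\<^sub>R D j"
    using stress[OF j(1)] by (simp add: algebra_simps)
  have "?T (v (Suc j)) (v j) - ?T (v j) (v k) = ?T (v (Suc j) - v k) (v j)"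
    using Tk'_sym[of "v j" "v k"] by (simp add: blinfun.diff_left blinfun.diff_right)
  also have "\<dots> = \<tau> * ?T (\<delta> j) (v j) + \<tau> * ?T (\<delta> k) (v j)"
    using tau by (simp add: j_def blinfun.diff_left blinfun.diff_right blinfun.scaleR_left blinfun.scaleR_right)
  also have "?T (\<delta> j) (v j) = blinfun_apply f (v j) - blinfun_apply ?Sn (blinfun_apply A (v j))"
    using momentum[OF j(1) vj] by simp
  also have "?T (\<delta> k) (v j) = blinfun_apply f (v j) - blinfun_apply ?Sj (blinfun_apply A (v j))"
    using momentum[OF j(2) vj, folded j_def] by (simp add: j_def)
  also have "\<tau> * (blinfun_apply f (v j) - blinfun_apply ?Sn (blinfun_apply A (v j)))
      + \<tau> * (blinfun_apply f (v j) - blinfun_apply ?Sj (blinfun_apply A (v j)))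
      = 2 * \<tau> * blinfun_apply f (v j) - blinfun_apply (?Sn + ?Sj) (\<tau> *\<^sub>R blinfun_apply A (v j))"
    by (simp add: blinfun.add_left blinfun.scaleR_right algebra_simps)
  also have "\<dots> = 2 * \<tau> * blinfun_apply f (v j) - blinfun_apply (?Sn + ?Sj) ?d + \<tau> * blinfun_apply (?Sn + ?Sj) (D j)"
    unfolding Av by (simp add: blinfun.diff_right blinfun.scaleR_right)
  finally have kin: "?T (v (Suc j)) (v j) - ?T (v j) (v k) = \<dots>" .
  \<comment> \<open>The stored energy is split in the order of the scheme: \<open>\<Sigma>\<close>
    moves at fixed \<open>z j\<close>, then \<open>flow_energy\<close> moves z at the new
    \<open>\<Sigma>\<close>.\<close>
  have pot: "\<Phi> (\<Sigma> (Suc j)) (z j) - \<Phi> (\<Sigma> j) (z j) = (1 / 2) * (blinfun_apply ?Sj ?d + blinfun_apply ?Sm ?d)"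
    using quadratic_increment(1)[OF Phi_quadratic(1) Phi_derivs(1), of "\<Sigma> (Suc j)" "z j" "\<Sigma> j"] .
  show ?thesis
    using kin pot flow_energy[OF j(1)] unfolding e_def
    by (simp add: j_def[symmetric] blinfun.add_left blinfun.diff_left algebra_simps)
qed

text \<open>The force contributes a multiple of \<tau> times 1 plus the squared velocity, the load
  enters with its summable weight, and the discrepancy in z uses up half of the dissipation.\<close>

lemma energy_step:
  assumes "Suc k < N"
  shows "e (Suc k) + \<tau> * (\<epsilon> / 2 * x (Suc k) powr p) \<le> (1 + \<tau> * c\<^sub>1) * e k + \<tau> * c\<^sub>2
    + c\<^sub>D * (\<tau> * norm (D (Suc k))) * (1 + sqrt (e k) + sqrt (e (Suc k)))"
proof -
  define j where "j = Suc k"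
  have j: "j < N" "k < N" using assms by (auto simp: j_def)
  let ?Sn = "\<Phi>S (\<Sigma> (Suc j)) (z (Suc j))" and ?Sj = "\<Phi>S (\<Sigma> j) (z j)" and ?Sm = "\<Phi>S (\<Sigma> (Suc j)) (z j)"
  let ?d = "\<Sigma> (Suc j) - \<Sigma> j" and ?v = "norm (v j)"
  interpret iota: bounded_linear \<iota> by (rule iota)
  have v2: "?v\<^sup>2 \<le> 2 / \<epsilon> * e k"
    using Y_le[OF j(2)] unfolding j_def[symmetric] Y_def
    using zero_le_power2[of "norm (\<Sigma> j)"] zero_le_power2[of "norm (z j)"] by linarith
  have "blinfun_apply f (v j) \<le> M * ?v"
    using norm_blinfun[of f "v j"] mult_right_mono[OF f_le, of ?v] by simp
  also have "\<dots> \<le> M * (1 + ?v\<^sup>2)"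
  proof (intro mult_left_mono M)
    have "0 \<le> (?v - 1/2)\<^sup>2" by simp
    then show "?v \<le> 1 + ?v\<^sup>2" by (simp add: power2_eq_square algebra_simps)
  qed
  finally have F: "blinfun_apply f (v j) \<le> M + M * ?v\<^sup>2" by (simp add: algebra_simps)
  have "blinfun_apply (?Sn + ?Sj) (D j) \<le> (norm ?Sn + norm ?Sj) * norm (D j)"
    using norm_blinfun[of "?Sn + ?Sj" "D j"] mult_right_mono[OF norm_triangle_ineq[of ?Sn ?Sj] norm_ge_zero[of "D j"]]
    by simp
  also have "\<dots> \<le> (c\<^sub>D * (1 + 2 * sqrt (e j)) / 2 + c\<^sub>D * (1 + 2 * sqrt (e k)) / 2) * norm (D j)"
    using PhiS_le_energy[OF j(1)] PhiS_le_energy[OF j(2)] unfolding j_def[symmetric]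
    by (intro mult_right_mono add_mono) auto
  also have "\<dots> = c\<^sub>D * norm (D j) * (1 + sqrt (e k) + sqrt (e j))" by (simp add: field_simps)
  finally have "\<tau> * blinfun_apply (?Sn + ?Sj) (D j) \<le> \<tau> * (c\<^sub>D * norm (D j) * (1 + sqrt (e k) + sqrt (e j)))"
    using tau by (intro mult_left_mono) auto
  moreover have "0 \<le> \<tau> * (c\<^sub>D * norm (D j) * (1 + sqrt (e k) + sqrt (e j)))"
    using tau constants_nonneg(7) energy_nonneg j by simp
  ultimately have load: "\<tau> / 2 * blinfun_apply (?Sn + ?Sj) (D j) \<le> c\<^sub>D * (\<tau> * norm (D j)) * (1 + sqrt (e k) + sqrt (e j))"
    by (simp add: algebra_simps)
  have xj: "norm (\<iota> (z j - z (Suc j))) = \<tau> * x j"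
    using tau by (simp add: iota.scaleR iota.diff norm_minus_commute)
  have "norm ?d \<le> \<tau> * (norm A * ?v) + \<tau> * norm (D j)"
    unfolding stress[OF j(1)] using tau norm_triangle_ineq[of "blinfun_apply A (v j)" "D j"] norm_blinfun[of A "v j"]
    by (simp add: distrib_left[symmetric])
  also have "\<dots> \<le> T * (M * ?v) + M"
    using tau_le_T A_le T M tau_D_le[OF j(1)] by (intro add_mono mult_mono) auto
  finally have d: "norm ?d \<le> M * (T * ?v + 1)" by (simp add: algebra_simps)
  have "blinfun_apply (?Sm - ?Sn) ?d \<le> norm (?Sm - ?Sn) * norm ?d"
    using norm_blinfun[of "?Sm - ?Sn" ?d] by simp
  also have "\<dots> \<le> (\<bar>L\<bar> * (\<tau> * x j)) * (M * (T * ?v + 1))"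
  proof (intro mult_mono d)
    have "norm (?Sm - ?Sn) \<le> L * (\<tau> * x j)" using PhiS_lipschitz[of "\<Sigma> (Suc j)" "z j" "z (Suc j)"] xj by simp
    also have "\<dots> \<le> \<bar>L\<bar> * (\<tau> * x j)" using tau by (intro mult_right_mono) auto
    finally show "norm (?Sm - ?Sn) \<le> \<bar>L\<bar> * (\<tau> * x j)" .
  qed (use tau in auto)
  finally have "(1 / 2) * blinfun_apply (?Sm - ?Sn) ?d \<le> \<tau> * ((1 / 2) * (x j * (\<bar>L\<bar> * M * (T * ?v + 1))))"
    by (simp add: algebra_simps)
  also have "\<dots> \<le> \<tau> * (\<epsilon> / 2 * (1 + x j powr p) + (L * M)\<^sup>2 / (4 * \<epsilon>) * (T\<^sup>2 * ?v\<^sup>2 + 1))"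
  proof (intro mult_left_mono)
    let ?y = "\<bar>L\<bar> * M * (T * ?v + 1)"
    \<comment> \<open>Young's inequality, weighted so that the square of \<open>x j\<close> takes
      the coefficient \<open>\<epsilon> / 2\<close>, half of that of the dissipation.\<close>
    have "0 \<le> (x j - ?y / (2 * \<epsilon>))\<^sup>2 * \<epsilon> / 2" using eps by simp
    also have "\<dots> = \<epsilon> / 2 * (x j)\<^sup>2 + ?y\<^sup>2 / (8 * \<epsilon>) - (1 / 2) * (x j * ?y)"
      using eps by (simp add: power2_eq_square field_simps)
    finally have 1: "(1 / 2) * (x j * ?y) \<le> \<epsilon> / 2 * (x j)\<^sup>2 + ?y\<^sup>2 / (8 * \<epsilon>)" by simp
    have 2: "\<epsilon> / 2 * (x j)\<^sup>2 \<le> \<epsilon> / 2 * (1 + x j powr p)"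
      using eps powr_bound[of "x j"] by (intro mult_left_mono) auto
    have "0 \<le> (T * ?v - 1)\<^sup>2" by simp
    then have "(T * ?v + 1)\<^sup>2 \<le> 2 * (T\<^sup>2 * ?v\<^sup>2 + 1)" by (simp add: power2_eq_square algebra_simps)
    then have "(L * M)\<^sup>2 / (8 * \<epsilon>) * (T * ?v + 1)\<^sup>2 \<le> (L * M)\<^sup>2 / (8 * \<epsilon>) * (2 * (T\<^sup>2 * ?v\<^sup>2 + 1))"
      using eps by (intro mult_left_mono) auto
    moreover have "?y\<^sup>2 / (8 * \<epsilon>) = (L * M)\<^sup>2 / (8 * \<epsilon>) * (T * ?v + 1)\<^sup>2"
      by (simp add: power_mult_distrib)
    moreover have "(L * M)\<^sup>2 / (8 * \<epsilon>) * (2 * (T\<^sup>2 * ?v\<^sup>2 + 1)) = (L * M)\<^sup>2 / (4 * \<epsilon>) * (T\<^sup>2 * ?v\<^sup>2 + 1)"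
      using eps by (simp add: field_simps)
    ultimately show "(1 / 2) * (x j * ?y) \<le> \<epsilon> / 2 * (1 + x j powr p) + (L * M)\<^sup>2 / (4 * \<epsilon>) * (T\<^sup>2 * ?v\<^sup>2 + 1)"
      using 1 2 by linarith
  qed (use tau in auto)
  finally have lip: "(1 / 2) * blinfun_apply (?Sm - ?Sn) ?d
      \<le> \<tau> * (\<epsilon> / 2 * (1 + x j powr p) + (L * M)\<^sup>2 / (4 * \<epsilon>) * (T\<^sup>2 * ?v\<^sup>2 + 1))" .
  \<comment> \<open>The collected coefficient of the squared velocity; the factor
    \<open>2 / \<epsilon>\<close> that converts this square into energy turns it into
    \<open>c\<^sub>1\<close>.\<close>
  let ?q = "M + (L * M)\<^sup>2 * T\<^sup>2 / (4 * \<epsilon>)"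
  have "?q * ?v\<^sup>2 \<le> ?q * (2 / \<epsilon> * e k)"
    using v2 M eps by (intro mult_left_mono) auto
  also have "\<dots> = c\<^sub>1 * e k" unfolding c\<^sub>1_def by (simp only: mult_ac)
  finally have Q: "?q * ?v\<^sup>2 \<le> c\<^sub>1 * e k" .
  have "\<tau> * blinfun_apply f (v j) + \<tau> * \<Psi>\<^sub>0
      + \<tau> * (\<epsilon> / 2 * (1 + x j powr p) + (L * M)\<^sup>2 / (4 * \<epsilon>) * (T\<^sup>2 * ?v\<^sup>2 + 1))
    \<le> \<tau> * (c\<^sub>1 * e k + c\<^sub>2 + \<epsilon> / 2 * x j powr p)"
    unfolding distrib_left[symmetric]
  proof (rule mult_left_mono)
    have "blinfun_apply f (v j) + \<Psi>\<^sub>0 + (\<epsilon> / 2 * (1 + x j powr p) + (L * M)\<^sup>2 / (4 * \<epsilon>) * (T\<^sup>2 * ?v\<^sup>2 + 1))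
       \<le> ?q * ?v\<^sup>2 + c\<^sub>2 + \<epsilon> / 2 * x j powr p"
      using F by (simp add: c\<^sub>2_def algebra_simps add_divide_distrib)
    then show "blinfun_apply f (v j) + \<Psi>\<^sub>0 + (\<epsilon> / 2 * (1 + x j powr p) + (L * M)\<^sup>2 / (4 * \<epsilon>) * (T\<^sup>2 * ?v\<^sup>2 + 1))
       \<le> c\<^sub>1 * e k + c\<^sub>2 + \<epsilon> / 2 * x j powr p" using Q by linarith
  qed (use tau in auto)
  then have "e j + \<tau> * (\<epsilon> * x j powr p) \<le> e k + \<tau> * (c\<^sub>1 * e k + c\<^sub>2 + \<epsilon> / 2 * x j powr p)
      + c\<^sub>D * (\<tau> * norm (D j)) * (1 + sqrt (e k) + sqrt (e j))"
    using energy_balance[OF assms] load lip unfolding j_def[symmetric] by linarith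
  then show ?thesis unfolding j_def[symmetric] by (simp add: algebra_simps)
qed

text \<open>The balance yields increments of the energy only from the second step on, so this one is
  controlled by the data. Starting the trapezoidal rule at zero \<open>\<Sigma>\<close> leaves only
  \<open>K\<^sub>\<Phi>\<close> and the growth of \<open>\<Phi>S\<close>. The dissipation is kept
  for \<open>flow_rate_bound\<close>.\<close>

lemma first_step: "\<Phi> (\<Sigma> 1) (z 1) + \<tau> * (\<epsilon> * x 0 powr p) \<le> r\<^sub>\<Phi>"
proof -
  have "norm (\<Sigma> 1 - \<Sigma> 0) \<le> \<tau> * (norm A * norm (v 0)) + \<tau> * norm (D 0)"
    using stress[OF N(1)] tau norm_triangle_ineq[of "blinfun_apply A (v 0)" "D 0"] norm_blinfun[of A "v 0"]
    by (simp add: distrib_left[symmetric])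
  also have "\<dots> \<le> T * (M * M) + M"
    using tau_le_T A_le T M init tau_D_le[OF N(1)] by (intro add_mono mult_mono) auto
  finally have S: "norm (\<Sigma> 1) \<le> r\<^sub>\<Sigma>"
    using norm_triangle_ineq2[of "\<Sigma> 1" "\<Sigma> 0"] init(2) by (simp add: r\<^sub>\<Sigma>_def power2_eq_square)
  have "\<Phi> (\<Sigma> 1) (z 0) - \<Phi> 0 (z 0)
      = (1 / 2) * (blinfun_apply (\<Phi>S 0 (z 0)) (\<Sigma> 1) + blinfun_apply (\<Phi>S (\<Sigma> 1) (z 0)) (\<Sigma> 1))"
    using quadratic_increment(1)[OF Phi_quadratic(1) Phi_derivs(1), of "\<Sigma> 1" "z 0" 0] by simp
  also have "\<dots> \<le> (1 / 2) * (norm (\<Phi>S 0 (z 0)) * norm (\<Sigma> 1) + norm (\<Phi>S (\<Sigma> 1) (z 0)) * norm (\<Sigma> 1))"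
    using norm_blinfun[of "\<Phi>S 0 (z 0)" "\<Sigma> 1"] norm_blinfun[of "\<Phi>S (\<Sigma> 1) (z 0)" "\<Sigma> 1"] by simp
  also have "\<dots> \<le> (1 / 2) * ((\<bar>C0\<bar> * (1 + r\<^sub>\<Sigma> + M)) * r\<^sub>\<Sigma> + (\<bar>C0\<bar> * (1 + r\<^sub>\<Sigma> + M)) * r\<^sub>\<Sigma>)"
    using S init constants_nonneg(2) M
    by (intro mult_left_mono add_mono mult_mono order_trans[OF PhiS_le]) auto
  finally have "\<Phi> (\<Sigma> 1) (z 0) \<le> K\<^sub>\<Phi> + \<bar>C0\<bar> * (1 + r\<^sub>\<Sigma> + M) * r\<^sub>\<Sigma>"
    using Phi_0_le[OF init(4)] by (simp add: algebra_simps)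
  moreover have "\<tau> * \<Psi>\<^sub>0 \<le> T * \<Psi>\<^sub>0" using tau_le_T Psi_0(2) by (intro mult_right_mono)
  ultimately show ?thesis using flow_energy[OF N(1)] by (simp add: r\<^sub>\<Phi>_def)
qed

text \<open>\<open>e 0\<close> contains \<open>v 1\<close>, which is not a datum: coercivity bounds
  \<open>\<Sigma> 1\<close> and \<open>z 1\<close>, these bound the acceleration, and \<tau> is at
  most T.\<close>

lemma initial_energy: "e 0 \<le> e\<^sub>0"
proof -
  have P1: "\<Phi> (\<Sigma> 1) (z 1) \<le> r\<^sub>\<Phi>"
  proof -
    have "0 \<le> \<tau> * (\<epsilon> * x 0 powr p)" using tau eps by simp
    then show ?thesis using first_step by linarith
  qed
  then have P2: "(norm (\<Sigma> 1))\<^sup>2 + (norm (z 1))\<^sup>2 \<le> r\<^sub>\<Phi> / \<epsilon>"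
    using Phi_coercive[of "\<Sigma> 1" "z 1"] eps by (simp add: pos_le_divide_eq algebra_simps)
  have "norm (\<Sigma> 1) \<le> sqrt (r\<^sub>\<Phi> / \<epsilon>)" "norm (z 1) \<le> sqrt (r\<^sub>\<Phi> / \<epsilon>)"
    by (rule real_le_rsqrt, use P2 zero_le_power2[of "norm (\<Sigma> 1)"] zero_le_power2[of "norm (z 1)"] in linarith)+
  then have "norm (\<delta> 0) \<le> c\<^sub>a * (1 + 2 * sqrt (r\<^sub>\<Phi> / \<epsilon>))"
    using constants_nonneg(1) by (intro order_trans[OF acceleration_le[OF N(1)]] mult_left_mono) auto
  then have "\<tau> * norm (\<delta> 0) \<le> T * (c\<^sub>a * (1 + 2 * sqrt (r\<^sub>\<Phi> / \<epsilon>)))"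
    using tau_le_T T by (intro mult_mono) auto
  moreover have "\<tau> * norm (\<delta> 0) = norm (v 1 - v 0)" using tau by simp
  ultimately have v1: "norm (v 1) \<le> r\<^sub>v"
    using norm_triangle_ineq2[of "v 1" "v 0"] init(3) by (simp add: r\<^sub>v_def)
  have "blinfun_apply (blinfun_apply Tk' (v 1)) (v 0) \<le> norm Tk' * norm (v 1) * norm (v 0)"
    using Tk'_bound[of "v 1" "v 0"] by simp
  also have "\<dots> \<le> norm Tk' * r\<^sub>v * M" using v1 init(3) constants_nonneg(4) by (intro mult_mono) auto
  finally show ?thesis using P1 by (simp add: e_def e\<^sub>0_def)
qed

lemma energy_bound:
  assumes "n < N"
  shows "e n + (\<Sum>k=1..n. \<tau> * (\<epsilon> / 2 * x k powr p)) \<le> e_bound"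
proof (rule discrete_gronwall_sqrt[where \<tau> = \<tau> and N = N and a = c\<^sub>1 and b = c\<^sub>2 and T = T and K = e\<^sub>0 and G = "c\<^sub>D * M"
      and g = "\<lambda>k. c\<^sub>D * (\<tau> * norm (D k))"])
  show "(\<Sum>k<N. c\<^sub>D * (\<tau> * norm (D k))) \<le> c\<^sub>D * M"
    using mult_left_mono[OF D_le constants_nonneg(7)] by (simp add: sum_distrib_left)
qed (use assms tau N energy_nonneg eps constants_nonneg initial_energy energy_step e_bound_def in auto)

section \<open>Uniform bounds for the discrete solution\<close>

lemma state_bounds:
  assumes "k \<le> N"
  shows "norm (v k) \<le> state_bound" "norm (\<Sigma> k) \<le> state_bound" "norm (z k) \<le> state_bound"
proof -
  have Y: "Y (Suc n) \<le> 2 * e_bound / \<epsilon>" if "n < N" for n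
  proof -
    have "0 \<le> (\<Sum>k=1..n. \<tau> * (\<epsilon> / 2 * x k powr p))" using tau eps by (intro sum_nonneg) auto
    then have "e n \<le> e_bound" using energy_bound[OF that] by linarith
    then have "2 / \<epsilon> * e n \<le> 2 / \<epsilon> * e_bound" using eps by (intro mult_left_mono) auto
    then show ?thesis using Y_le[OF that] by simp
  qed
  have "norm (v k) \<le> state_bound \<and> norm (\<Sigma> k) \<le> state_bound \<and> norm (z k) \<le> state_bound"
  proof (cases k)
    case 0
    then show ?thesis using init constants_nonneg(9) by simp
  next
    case (Suc n)
    then have "sqrt (Y k) \<le> sqrt (2 * e_bound / \<epsilon>)" using Y[of n] assms by simp
    then show ?thesis using norm_le_sqrt_Y[of k] M unfolding state_bound_def by linarith
  qed
  then show "norm (v k) \<le> state_bound" "norm (\<Sigma> k) \<le> state_bound" "norm (z k) \<le> state_bound" by auto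
qed

lemma acceleration_bound:
  assumes "k < N"
  shows "norm (\<delta> k) \<le> c\<^sub>a * (1 + 2 * state_bound)"
  using acceleration_le[OF assms] state_bounds[of "Suc k"] assms constants_nonneg(1)
  by (elim order_trans) (auto intro!: mult_left_mono)

lemma displacement_bound: "k \<le> N \<Longrightarrow> norm (u k) \<le> M + T * state_bound"
proof -
  have "k \<le> N \<Longrightarrow> norm (u k) \<le> M + real k * \<tau> * state_bound"
  proof (induction k)
    case (Suc k)
    have "norm (u (Suc k)) \<le> norm (u k) + \<tau> * norm (v (Suc k))"
      using displacement[of k] Suc.prems norm_triangle_ineq[of "u k" "\<tau> *\<^sub>R v (Suc k)"] tau by simp
    also have "\<dots> \<le> (M + real k * \<tau> * state_bound) + \<tau> * state_bound"
      using Suc state_bounds(1)[of "Suc k"] tau by (intro add_mono mult_left_mono) auto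
    finally show ?case by (simp add: algebra_simps)
  qed (use init in simp)
  moreover assume k: "k \<le> N"
  moreover have "real k * \<tau> * state_bound \<le> T * state_bound"
    using k N(2) tau constants_nonneg(9) M by (intro mult_right_mono) auto
  ultimately show ?thesis by linarith
qed

text \<open>The velocity part is bounded at each level, the load rate only in the sum; this is why
  the rate of \<open>\<Sigma>\<close> is estimated in L1 in time.\<close>

lemma stress_rate_bound: "(\<Sum>k<N. \<tau> * norm ((1 / \<tau>) *\<^sub>R (\<Sigma> (Suc k) - \<Sigma> k))) \<le> T * (M * state_bound) + M"
proof -
  have "(\<Sum>k<N. \<tau> * norm ((1 / \<tau>) *\<^sub>R (\<Sigma> (Suc k) - \<Sigma> k))) \<le> (\<Sum>k<N. \<tau> * (M * state_bound) + \<tau> * norm (D k))"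
  proof (intro sum_mono)
    fix k assume "k \<in> {..<N}"
    then have k: "k < N" by simp
    have "norm (blinfun_apply A (v k)) \<le> norm A * norm (v k)" by (rule norm_blinfun)
    also have "\<dots> \<le> M * state_bound" using A_le M state_bounds(1)[of k] k by (intro mult_mono) auto
    finally have "norm (blinfun_apply A (v k) + D k) \<le> M * state_bound + norm (D k)"
      using norm_triangle_ineq[of "blinfun_apply A (v k)" "D k"] by linarith
    then show "\<tau> * norm ((1 / \<tau>) *\<^sub>R (\<Sigma> (Suc k) - \<Sigma> k)) \<le> \<tau> * (M * state_bound) + \<tau> * norm (D k)"
      using stress[OF k] tau by (simp add: distrib_left[symmetric])
  qed
  also have "\<dots> = T * (M * state_bound) + (\<Sum>k<N. \<tau> * norm (D k))"
    using N(2) by (simp add: sum.distrib mult.assoc[symmetric])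
  finally show ?thesis using D_le by linarith
qed

lemma flow_rate_bound: "(\<Sum>k<N. \<tau> * x k powr p) \<le> r\<^sub>\<Phi> / \<epsilon> + 2 * e_bound / \<epsilon>"
proof -
  \<comment> \<open>The Gronwall sum starts at 1; the dissipation of step 0 comes from
    \<open>first_step\<close>.\<close>
  have "{..<N} = insert 0 {1..N - 1}" using N by auto
  then have "(\<Sum>k<N. \<tau> * x k powr p) = \<tau> * x 0 powr p + (\<Sum>k=1..N - 1. \<tau> * x k powr p)" by simp
  moreover have "\<tau> * x 0 powr p \<le> r\<^sub>\<Phi> / \<epsilon>"
    using first_step Phi_nonneg[of "\<Sigma> 1" "z 1"] eps by (simp add: pos_le_divide_eq algebra_simps)
  moreover have "(\<Sum>k=1..N - 1. \<tau> * x k powr p) \<le> 2 * e_bound / \<epsilon>"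
  proof -
    have "(\<Sum>k=1..N - 1. \<tau> * (\<epsilon> / 2 * x k powr p)) \<le> e_bound"
      using energy_bound[of "N - 1"] energy_nonneg[of "N - 1"] N by simp
    moreover have "(\<Sum>k=1..N - 1. \<tau> * (\<epsilon> / 2 * x k powr p)) = \<epsilon> / 2 * (\<Sum>k=1..N - 1. \<tau> * x k powr p)"
      by (simp add: sum_distrib_left mult.left_commute)
    ultimately show ?thesis using eps by (simp add: field_simps)
  qed
  ultimately show ?thesis by linarith
qed

end

section \<open>The norms of the dual spaces\<close>

lemma U_unit_ball_0:
  assumes "linear E" "linear j" "inj j"
  shows "0 \<in> {u \<in> U_space E j. U_norm E j u \<le> 1}"
proof -
  have "E 0 = j 0" using assms(1,2) by (simp add: linear_0)
  then have "E 0 \<in> range j" "inv j (E 0) = 0" using assms(3) by (auto simp: inv_f_f)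
  then show ?thesis by (simp add: U_space_def U_norm_def E_op_def)
qed

text \<open>The graph norm dominates the norm of H, so bounds in the dual of H pass to the dual of
  U.\<close>

lemma U_dual_norm_le:
  assumes "linear E" "linear j" "inj j"
  shows "U_dual_norm E j f \<le> norm f"
  unfolding U_dual_norm_def
proof (rule cSUP_least)
  show "{u \<in> U_space E j. U_norm E j u \<le> 1} \<noteq> {}" using U_unit_ball_0[OF assms] by blast
  fix u assume "u \<in> {u \<in> U_space E j. U_norm E j u \<le> 1}"
  then have "norm u \<le> 1"
    using norm_ge_zero[of "E_op E j u"] unfolding U_norm_def mem_Collect_eq by linarith
  then have "norm f * norm u \<le> norm f" by (simp add: mult_left_le)
  then show "\<bar>blinfun_apply f u\<bar> \<le> norm f" using norm_blinfun[of f u] by simp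
qed

lemma U_dual_norm_0:
  assumes "linear E" "linear j" "inj j"
  shows "U_dual_norm E j 0 = 0"
  using U_unit_ball_0[OF assms] by (auto simp: U_dual_norm_def intro!: cSUP_const)

text \<open>Density of U makes the representative of the zero functional unique, so the
  \<open>THE\<close> in \<open>X_norm\<close> evaluates to 0.\<close>

lemma X_unit_ball_0:
  assumes "closure (U_space E j) = UNIV"
  shows "0 \<in> {X \<in> X_space E j \<CC>. X_norm E j \<CC> X \<le> 1}"
proof -
  have rep: "represents_EC E j \<CC> 0 w \<longleftrightarrow> w = 0" for w
  proof
    assume "represents_EC E j \<CC> 0 w"
    then have "U_space E j \<subseteq> {u. blinfun_apply w u = 0}"
      by (auto simp: represents_EC_def adjoint_op_def)
    moreover have "closed {u. blinfun_apply w u = 0}"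
      by (intro closed_Collect_eq continuous_intros)
    ultimately have "closure (U_space E j) \<subseteq> {u. blinfun_apply w u = 0}" by (rule closure_minimal)
    then have "blinfun_apply w u = 0" for u using assms by blast
    then show "w = 0" by (intro blinfun_eqI) simp
  qed (simp add: represents_EC_def adjoint_op_def)
  then have "(THE w. represents_EC E j \<CC> 0 w) = 0" by simp
  then have "X_norm E j \<CC> 0 \<le> 1" by (simp add: X_norm_def)
  moreover have "0 \<in> X_space E j \<CC>" unfolding X_space_def using rep by blast
  ultimately show ?thesis by simp
qed

lemma X_dual_norm_bounds:
  assumes "closure (U_space E j) = UNIV"
  shows "X_dual_norm E j \<CC> \<sigma> \<le> norm \<sigma>" "0 \<le> X_dual_norm E j \<CC> \<sigma>"
proof -
  let ?B = "{X \<in> X_space E j \<CC>. X_norm E j \<CC> X \<le> 1}"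
  have le: "\<bar>blinfun_apply X \<sigma>\<bar> \<le> norm \<sigma>" if "X \<in> ?B" for X
  proof -
    have "norm X \<le> 1"
      using that norm_ge_zero[of "THE w. represents_EC E j \<CC> X w"] unfolding X_norm_def mem_Collect_eq by linarith
    then have "norm X * norm \<sigma> \<le> norm \<sigma>" by (simp add: mult_left_le_one_le)
    then show ?thesis using norm_blinfun[of X \<sigma>] by simp
  qed
  show "X_dual_norm E j \<CC> \<sigma> \<le> norm \<sigma>"
    unfolding X_dual_norm_def using X_unit_ball_0[OF assms] le by (intro cSUP_least) auto
  have "bdd_above ((\<lambda>X. \<bar>blinfun_apply X \<sigma>\<bar>) ` ?B)" using le by (rule bdd_aboveI2)
  from cSUP_upper[OF X_unit_ball_0[OF assms] this]
  show "0 \<le> X_dual_norm E j \<CC> \<sigma>" by (simp add: X_dual_norm_def)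
qed

section \<open>From the discrete solution to its interpolants\<close>

theorem proposition4p1:
  fixes T :: real
    and E :: "'h::{real_inner,complete_space} \<Rightarrow> 'w::real_vector"
    and j :: "'e::banach \<Rightarrow> 'w"
    and \<CC> :: "'e \<Rightarrow>\<^sub>L 's::banach"
    and \<iota> :: "'z::banach \<Rightarrow> 'z1::banach"
    and Tk :: "'h \<Rightarrow> real" and Tk' :: "'h \<Rightarrow>\<^sub>L 'h dual"
    and \<Phi> :: "'s \<Rightarrow> 'z \<Rightarrow> real"
    and \<Phi>S :: "'s \<Rightarrow> 'z \<Rightarrow> 's dual" and \<Phi>Z :: "'s \<Rightarrow> 'z \<Rightarrow> 'z dual"
    and \<Psi> :: "'z \<Rightarrow> ereal"
    and Vh :: "real \<Rightarrow> 'h set" and Sh :: "real \<Rightarrow> 's set" and Zh :: "real \<Rightarrow> 'z set"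
    and Eh :: "real \<Rightarrow> ('h \<Rightarrow>\<^sub>L 'e)"
    and F :: "'h dual" and Fh :: "real \<Rightarrow> 'h dual"
    and G :: "real \<Rightarrow> 's" and Gh :: "real \<Rightarrow> real \<Rightarrow> 's"
    and u0 :: 'h and \<Sigma>0 :: 's and v0 :: 'h and z0 :: 'z
    and u0h :: "real \<Rightarrow> real \<Rightarrow> 'h" and \<Sigma>0h :: "real \<Rightarrow> real \<Rightarrow> 's"
    and v0h :: "real \<Rightarrow> real \<Rightarrow> 'h" and z0h :: "real \<Rightarrow> real \<Rightarrow> 'z"
    and \<epsilon> p C0 L \<eta> :: real
  assumes T: "T > 0"
    \<comment> \<open>spaces and operators\<close>
    and E: "linear E" and j: "linear j" "inj j"
    and U: "U_complete E j" "closure (U_space E j) = UNIV"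
    and CC: "bij (blinfun_apply \<CC>)"
    and Z_Z1: "bounded_linear \<iota>" "inj \<iota>"
    \<comment> \<open>functionals\<close>
    and Tk: "\<And>v. Tk v = (1 / 2) * blinfun_apply (blinfun_apply Tk' v) v"
            "\<And>v. has_gateaux_derivative Tk (blinfun_apply Tk' v) v"
    and Phi_smooth: "smooth_fun (\<lambda>(\<sigma>, z). \<Phi> \<sigma> z)"
    and Phi_quadratic: "\<And>z. quadratic_fun (\<lambda>\<sigma>. \<Phi> \<sigma> z)" "\<And>\<sigma>. quadratic_fun (\<Phi> \<sigma>)"
    and Phi_derivs: "\<And>\<sigma> z. has_gateaux_derivative (\<lambda>s. \<Phi> s z) (\<Phi>S \<sigma> z) \<sigma>"
                    "\<And>\<sigma> z. has_gateaux_derivative (\<Phi> \<sigma>) (\<Phi>Z \<sigma> z) z"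
    and Psi: "\<And>z. \<Psi> z \<ge> 0" "\<Psi> 0 < \<infinity>" "convex_functional \<Psi>" "lower_semicontinuous \<Psi>"
    \<comment> \<open>discretisation\<close>
    and subspaces: "\<And>h. h > 0 \<Longrightarrow> findim_subspace (Vh h)"
                   "\<And>h. h > 0 \<Longrightarrow> findim_subspace (Sh h)"
                   "\<And>h. h > 0 \<Longrightarrow> findim_subspace (Zh h)"
    and Eh_bounded: "\<exists>M. \<forall>h>0. norm (Eh h) \<le> M"
    and Eh_range: "\<And>h w. h > 0 \<Longrightarrow> w \<in> Vh h \<Longrightarrow> blinfun_apply \<CC> (blinfun_apply (Eh h) w) \<in> Sh h"
    and Fh: "\<exists>M. \<forall>h>0. norm (Fh h) \<le> M" "(Fh \<longlongrightarrow> F) (at_right 0)"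
    and Gh: "\<exists>M. \<forall>h>0. W11_norm T (Gh h) \<le> ennreal M"
            "((\<lambda>h. W11_norm T (\<lambda>t. Gh h t - G t)) \<longlongrightarrow> 0) (at_right 0)"
            "\<And>h t. h > 0 \<Longrightarrow> t \<in> {0..T} \<Longrightarrow> Gh h t \<in> Sh h"
    and init_spaces: "\<And>\<tau> h. \<tau> \<in> time_steps T \<Longrightarrow> h > 0 \<Longrightarrow>
            u0h \<tau> h \<in> Vh h \<and> \<Sigma>0h \<tau> h \<in> Sh h \<and> v0h \<tau> h \<in> Vh h \<and> z0h \<tau> h \<in> Zh h"
    and init_bounded: "\<exists>M. \<forall>\<tau>\<in>time_steps T. \<forall>h>0.
            norm (u0h \<tau> h) \<le> M \<and> norm (\<Sigma>0h \<tau> h) \<le> M \<and> norm (v0h \<tau> h) \<le> M \<and> norm (z0h \<tau> h) \<le> M"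
    and init_conv: "\<And>\<tau>. \<tau> \<in> time_steps T \<Longrightarrow>
            (u0h \<tau> \<longlongrightarrow> u0) (at_right 0) \<and> (\<Sigma>0h \<tau> \<longlongrightarrow> \<Sigma>0) (at_right 0) \<and>
            (v0h \<tau> \<longlongrightarrow> v0) (at_right 0) \<and> (z0h \<tau> \<longlongrightarrow> z0) (at_right 0)"
    \<comment> \<open>data\<close>
    and G: "W11_norm T G < top"
    and u0: "u0 \<in> U_space E j"
    and Sigma0: "\<Sigma>0 = blinfun_apply \<CC> (E_op E j u0) + G 0"
    \<comment> \<open>coercivity and growth\<close>
    and eps_p: "\<epsilon> > 0" "p \<ge> 2"
    and Tk_coercive: "\<And>v. Tk v \<ge> \<epsilon> * (norm v)\<^sup>2"
    and Phi_coercive: "\<And>\<sigma> z. \<Phi> \<sigma> z \<ge> \<epsilon> * (norm \<sigma>)\<^sup>2 + \<epsilon> * (norm z)\<^sup>2"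
    and Psi_coercive: "\<And>z. \<Psi> z \<ge> ereal (\<epsilon> * norm (\<iota> z) powr p)"
    and PhiS_growth: "\<And>\<sigma> z. norm (\<Phi>S \<sigma> z) \<le> C0 * (1 + norm \<sigma> + norm z)"
    and PhiS_lipschitz: "\<And>\<sigma> z z'. norm (\<Phi>S \<sigma> z - \<Phi>S \<sigma> z') \<le> L * norm (\<iota> (z - z'))"
    and eta: "0 < \<eta>" "\<eta> < 4"
  shows "\<exists>\<tau>0>0. \<exists>C::real. \<forall>\<tau>\<in>time_steps T. \<forall>h>0. \<forall>u \<Sigma> v z.
      \<tau> \<le> \<tau>0 \<longrightarrow>
      CFL \<eta> \<tau> (Sh h) (Zh h) \<CC> (Eh h) Tk' \<Phi> \<Phi>S \<longrightarrow>
      u 0 = u0h \<tau> h \<and> \<Sigma> 0 = \<Sigma>0h \<tau> h \<and> v 0 = v0h \<tau> h \<and> z 0 = z0h \<tau> h \<longrightarrow>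
      staggered_solution T \<tau> (Vh h) (Sh h) (Zh h) \<CC> (Eh h) Tk' \<Phi>S \<Phi>Z \<Psi> (Fh h) (Gh h) u \<Sigma> v z \<longrightarrow>
      W1inf_norm T (affine_interp \<tau> u) \<le> ennreal C \<and>
      Linf_norm T norm (affine_interp \<tau> \<Sigma>) \<le> ennreal C \<and>
      Lp_norm T 1 (X_dual_norm E j \<CC>) (time_deriv (affine_interp \<tau> \<Sigma>)) \<le> ennreal C \<and>
      Linf_norm T norm (affine_interp \<tau> v) \<le> ennreal C \<and>
      Linf_norm T (U_dual_norm E j) (\<lambda>t. blinfun_apply Tk' (time_deriv (affine_interp \<tau> v) t)) \<le> ennreal C \<and>
      Linf_norm T norm (affine_interp \<tau> z) \<le> ennreal C \<and>
      Lp_norm T p norm (\<lambda>t. \<iota> (time_deriv (affine_interp \<tau> z) t)) \<le> ennreal C"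
proof -
  obtain ME where ME: "\<And>h. h > 0 \<Longrightarrow> norm (Eh h) \<le> ME" using Eh_bounded by blast
  obtain MF where MF: "\<And>h. h > 0 \<Longrightarrow> norm (Fh h) \<le> MF" using Fh(1) by blast
  obtain MG where MG: "\<And>h. h > 0 \<Longrightarrow> W11_norm T (Gh h) \<le> ennreal MG" using Gh(1) by blast
  obtain MI where MI: "\<And>\<tau> h. \<tau> \<in> time_steps T \<Longrightarrow> h > 0 \<Longrightarrow>
      norm (u0h \<tau> h) \<le> MI \<and> norm (\<Sigma>0h \<tau> h) \<le> MI \<and> norm (v0h \<tau> h) \<le> MI \<and> norm (z0h \<tau> h) \<le> MI"
    using init_bounded by blast
  \<comment> \<open>The absolute value matters for \<open>MG\<close>, whose sign
    \<open>ennreal\<close> hides.\<close>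
  define M where "M = norm \<CC> * \<bar>ME\<bar> + \<bar>MF\<bar> + \<bar>MG\<bar> + \<bar>MI\<bar>"
  have M_le: "0 \<le> M" "norm \<CC> * \<bar>ME\<bar> \<le> M" "MF \<le> M" "MG \<le> M" "MI \<le> M"
    unfolding M_def using mult_nonneg_nonneg[OF norm_ge_zero[of \<CC>] abs_ge_zero[of ME]] by linarith+
  obtain K where K: "\<And>z. norm z \<le> M \<Longrightarrow> \<Phi> 0 z \<le> K"
    using quadratic_bounded_on_ball[OF Phi_quadratic(2)] by blast
  interpret energy_data \<iota> Tk Tk' \<Phi> \<Phi>S \<Phi>Z \<Psi> \<epsilon> p C0 L T M K
    by (rule energy_data.intro) (fact | rule Psi(1) | erule K)+
  \<comment> \<open>One nonnegative summand per kind of estimate, so that each lies below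
    \<open>C\<close>.\<close>
  define C where "C = (M + T * state_bound + state_bound) + state_bound + (T * (M * state_bound) + M)
      + norm Tk' * (c\<^sub>a * (1 + 2 * state_bound)) + (r\<^sub>\<Phi> / \<epsilon> + 2 * e_bound / \<epsilon>) powr (1 / p)"
  have sb: "0 \<le> state_bound" using constants_nonneg(9) M_le(1) by linarith
  have nn: "0 \<le> M + T * state_bound + state_bound" "0 \<le> T * (M * state_bound) + M"
    "0 \<le> norm Tk' * (c\<^sub>a * (1 + 2 * state_bound))" "0 \<le> (r\<^sub>\<Phi> / \<epsilon> + 2 * e_bound / \<epsilon>) powr (1 / p)"
    using sb M_le(1) T constants_nonneg(1) by simp_all
  have C: "M + T * state_bound + state_bound \<le> C" "state_bound \<le> C" "T * (M * state_bound) + M \<le> C"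
    "norm Tk' * (c\<^sub>a * (1 + 2 * state_bound)) \<le> C" "(r\<^sub>\<Phi> / \<epsilon> + 2 * e_bound / \<epsilon>) powr (1 / p) \<le> C"
    using nn sb unfolding C_def by linarith+
  \<comment> \<open>Chosen for the smallness condition
    \<open>\<tau> * (norm Tk' * c\<^sub>a) \<le> \<epsilon>\<close> of \<open>staggered_run\<close>;
    the added 1 excludes a zero denominator.\<close>
  define \<tau>0 where "\<tau>0 = \<epsilon> / (norm Tk' * c\<^sub>a + 1)"
  have q: "0 < norm Tk' * c\<^sub>a + 1" using constants_nonneg(1) by (simp add: add_nonneg_pos)
  show ?thesis
  proof (rule exI[of _ \<tau>0], intro conjI exI[of _ C] ballI allI impI)
    show "\<tau>0 > 0" unfolding \<tau>0_def using eps_p(1) q by simp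
  next
    fix \<tau> h u \<Sigma> v z
    assume \<tau>: "\<tau> \<in> time_steps T" and h: "0 < h" and le: "\<tau> \<le> \<tau>0"
      and ini: "u 0 = u0h \<tau> h \<and> \<Sigma> 0 = \<Sigma>0h \<tau> h \<and> v 0 = v0h \<tau> h \<and> z 0 = z0h \<tau> h"
      and sol: "staggered_solution T \<tau> (Vh h) (Sh h) (Zh h) \<CC> (Eh h) Tk' \<Phi>S \<Phi>Z \<Psi> (Fh h) (Gh h) u \<Sigma> v z"
    have tau: "\<tau> > 0" using \<tau> by (simp add: time_steps_def)
    obtain N where "T / \<tau> = real N" using \<tau> by (auto simp: time_steps_def elim: Nats_cases)
    then have NT: "real N * \<tau> = T" and lt: "real k < T / \<tau> \<longleftrightarrow> k < N" for k
      using tau by (auto simp: field_simps)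
    have sub: "subspace (Vh h)" "subspace (Zh h)"
      using subspaces(1,3)[OF h] by (auto simp: findim_subspace_def)
    have sol: "\<Sigma> (Suc k) \<in> Sh h \<and>
         (1 / \<tau>) *\<^sub>R (\<Sigma> (Suc k) - \<Sigma> k) = blinfun_apply \<CC> (blinfun_apply (Eh h) (v k)) + load_rate (Gh h) \<tau> k"
       "\<And>z'. z' \<in> Zh h \<Longrightarrow> \<Psi> z' + ereal (blinfun_apply (\<Phi>Z (\<Sigma> (Suc k)) ((1 / 2) *\<^sub>R (z (Suc k) + z k)))
                        (z' - (1 / \<tau>) *\<^sub>R (z (Suc k) - z k))) \<ge> \<Psi> ((1 / \<tau>) *\<^sub>R (z (Suc k) - z k))"
       "v (Suc k) \<in> Vh h"
       "\<And>w. w \<in> Vh h \<Longrightarrow> blinfun_apply (blinfun_apply Tk' ((1 / \<tau>) *\<^sub>R (v (Suc k) - v k))) w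
            + blinfun_apply (adjoint_op (Eh h) (adjoint_op \<CC> (\<Phi>S (\<Sigma> (Suc k)) (z (Suc k))))) w = blinfun_apply (Fh h) w"
       "u (Suc k) = u k + \<tau> *\<^sub>R v (Suc k)" if "k < N" for k
      using sol that unfolding staggered_solution_def lt by blast+
    interpret staggered_run \<iota> Tk Tk' \<Phi> \<Phi>S \<Phi>Z \<Psi> \<epsilon> p C0 L T M K \<tau> N "Vh h" "\<CC> o\<^sub>L Eh h" "Fh h"
      "load_rate (Gh h) \<tau>" u \<Sigma> v z
    proof
      show "\<tau> > 0" by (rule tau)
      show "N > 0" using NT T by (cases N) auto
      show "real N * \<tau> = T" by (rule NT)
      have "\<tau> * (norm Tk' * c\<^sub>a) \<le> \<tau> * (norm Tk' * c\<^sub>a + 1)" using tau by simp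
      also have "\<dots> \<le> \<epsilon>" using le q by (simp add: \<tau>0_def pos_le_divide_eq)
      finally show "\<tau> * (norm Tk' * c\<^sub>a) \<le> \<epsilon>" .
      have "norm (Eh h) \<le> \<bar>ME\<bar>" using ME[OF h] by linarith
      then show "norm (\<CC> o\<^sub>L Eh h) \<le> M"
        using M_le(2) norm_blinfun_compose[of \<CC> "Eh h"] mult_left_mono[of "norm (Eh h)" "\<bar>ME\<bar>" "norm \<CC>"] by simp
      show "norm (Fh h) \<le> M" using MF[OF h] M_le(3) by linarith
      have "W11_norm (real N * \<tau>) (Gh h) \<le> ennreal M"
        unfolding NT using MG[OF h] M_le(4) by (meson ennreal_leI order_trans)
      then show "(\<Sum>k<N. \<tau> * norm (load_rate (Gh h) \<tau> k)) \<le> M"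
        using M_le(1) tau by (rule sum_load_rate_le)
      show "norm (u 0) \<le> M" "norm (\<Sigma> 0) \<le> M" "norm (v 0) \<le> M" "norm (z 0) \<le> M"
        using ini MI[OF \<tau> h] M_le(5) by auto
      show "subspace (Vh h)" by (rule sub)
      show "v k \<in> Vh h" if "k \<le> N" for k
        using that ini init_spaces[OF \<tau> h] sol(3) by (cases k) auto
      fix k assume k: "k < N"
      have "\<Sigma> (Suc k) - \<Sigma> k = \<tau> *\<^sub>R ((1 / \<tau>) *\<^sub>R (\<Sigma> (Suc k) - \<Sigma> k))" using tau by simp
      then show "\<Sigma> (Suc k) - \<Sigma> k = \<tau> *\<^sub>R (blinfun_apply (\<CC> o\<^sub>L Eh h) (v k) + load_rate (Gh h) \<tau> k)"
        using sol(1)[OF k] by simp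
      show "\<Psi> ((1 / \<tau>) *\<^sub>R (z (Suc k) - z k)) \<le> \<Psi> 0 +
          ereal (blinfun_apply (\<Phi>Z (\<Sigma> (Suc k)) ((1 / 2) *\<^sub>R (z (Suc k) + z k))) (0 - (1 / \<tau>) *\<^sub>R (z (Suc k) - z k)))"
        by (rule sol(2)[OF k subspace_0[OF sub(2)]])
      show "u (Suc k) = u k + \<tau> *\<^sub>R v (Suc k)" by (rule sol(5)[OF k])
      fix w assume w: "w \<in> Vh h"
      show "blinfun_apply (blinfun_apply Tk' ((1 / \<tau>) *\<^sub>R (v (Suc k) - v k))) w
          + blinfun_apply (\<Phi>S (\<Sigma> (Suc k)) (z (Suc k))) (blinfun_apply (\<CC> o\<^sub>L Eh h) w) = blinfun_apply (Fh h) w"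
        using sol(4)[OF k w] by (simp add: adjoint_op_def)
    qed
    have "W1inf_norm (real N * \<tau>) (affine_interp \<tau> u) \<le> ennreal (M + T * state_bound) + ennreal state_bound"
    proof (rule W1inf_norm_affine_interp_le[OF tau displacement_bound])
      fix k assume k: "k < N"
      have "(1 / \<tau>) *\<^sub>R (u (Suc k) - u k) = v (Suc k)" using displacement[OF k] tau by simp
      then show "norm ((1 / \<tau>) *\<^sub>R (u (Suc k) - u k)) \<le> state_bound" using state_bounds(1)[of "Suc k"] k by simp
    qed
    also have "\<dots> = ennreal (M + T * state_bound + state_bound)"
      using sb M_le(1) T by (intro ennreal_plus[symmetric]) auto
    finally show "W1inf_norm T (affine_interp \<tau> u) \<le> ennreal C"
      unfolding NT using C(1) by (meson ennreal_leI order_trans)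
    have CC: "ennreal state_bound \<le> ennreal C" using C(2) by (rule ennreal_leI)
    show "Linf_norm T norm (affine_interp \<tau> \<Sigma>) \<le> ennreal C"
      using order_trans[OF Linf_norm_affine_interp_le[where N = N and w = \<Sigma>, OF tau state_bounds(2)] CC]
      unfolding NT by blast
    show "Linf_norm T norm (affine_interp \<tau> v) \<le> ennreal C"
      using order_trans[OF Linf_norm_affine_interp_le[where N = N and w = v, OF tau state_bounds(1)] CC]
      unfolding NT by blast
    show "Linf_norm T norm (affine_interp \<tau> z) \<le> ennreal C"
      using order_trans[OF Linf_norm_affine_interp_le[where N = N and w = z, OF tau state_bounds(3)] CC]
      unfolding NT by blast
    note X = X_dual_norm_bounds[OF U(2), of \<CC>]
    interpret stress: step_function \<tau> N "X_dual_norm E j \<CC>" "time_deriv (affine_interp \<tau> \<Sigma>)"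
      "\<lambda>k. (1 / \<tau>) *\<^sub>R (\<Sigma> (Suc k) - \<Sigma> k)"
    proof
      show "X_dual_norm E j \<CC> 0 = 0" using X[of 0] by simp
    qed (use tau time_deriv_affine_interp(2) in auto)
    have "(\<Sum>k<N. \<tau> * X_dual_norm E j \<CC> ((1 / \<tau>) *\<^sub>R (\<Sigma> (Suc k) - \<Sigma> k)) powr 1)
        \<le> (\<Sum>k<N. \<tau> * norm ((1 / \<tau>) *\<^sub>R (\<Sigma> (Suc k) - \<Sigma> k)))"
    proof (intro sum_mono mult_left_mono)
      \<comment> \<open>Nonnegativity of the dual norm makes \<open>powr 1\<close> the
        identity.\<close>
      fix k show "X_dual_norm E j \<CC> ((1 / \<tau>) *\<^sub>R (\<Sigma> (Suc k) - \<Sigma> k)) powr 1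
          \<le> norm ((1 / \<tau>) *\<^sub>R (\<Sigma> (Suc k) - \<Sigma> k))"
        by (subst powr_one[OF X(2)]) (rule X(1))
    qed (use tau in auto)
    from stress.Lp_norm_le[OF _ order_trans[OF this stress_rate_bound]]
    have "Lp_norm T 1 (X_dual_norm E j \<CC>) (time_deriv (affine_interp \<tau> \<Sigma>)) \<le> ennreal (T * (M * state_bound) + M)"
      using nn(2) unfolding NT by simp
    then show "Lp_norm T 1 (X_dual_norm E j \<CC>) (time_deriv (affine_interp \<tau> \<Sigma>)) \<le> ennreal C"
      using C(3) by (meson ennreal_leI order_trans)
    interpret inertia: step_function \<tau> N "U_dual_norm E j" "\<lambda>t. blinfun_apply Tk' (time_deriv (affine_interp \<tau> v) t)"
      "\<lambda>k. blinfun_apply Tk' ((1 / \<tau>) *\<^sub>R (v (Suc k) - v k))"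
      by standard (simp_all only: tau U_dual_norm_0[OF assms(2-4)] time_deriv_affine_interp(2))
    have "U_dual_norm E j (blinfun_apply Tk' ((1 / \<tau>) *\<^sub>R (v (Suc k) - v k))) \<le> C" if "k < N" for k
    proof -
      have "U_dual_norm E j (blinfun_apply Tk' ((1 / \<tau>) *\<^sub>R (v (Suc k) - v k)))
          \<le> norm Tk' * norm ((1 / \<tau>) *\<^sub>R (v (Suc k) - v k))"
        using U_dual_norm_le[OF assms(2-4)] norm_blinfun by (rule order_trans)
      also have "\<dots> \<le> norm Tk' * (c\<^sub>a * (1 + 2 * state_bound))"
        using acceleration_bound[OF that] by (rule mult_left_mono) simp
      finally show ?thesis using C(4) by linarith
    qed
    from inertia.Linf_norm_le[OF this]
    show "Linf_norm T (U_dual_norm E j) (\<lambda>t. blinfun_apply Tk' (time_deriv (affine_interp \<tau> v) t)) \<le> ennreal C"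
      unfolding NT .
    interpret flow: step_function \<tau> N norm "\<lambda>t. \<iota> (time_deriv (affine_interp \<tau> z) t)"
      "\<lambda>k. \<iota> ((1 / \<tau>) *\<^sub>R (z (Suc k) - z k))"
      by standard (simp_all only: tau norm_zero time_deriv_affine_interp(2))
    have "p > 0" using eps_p by simp
    from flow.Lp_norm_le[OF this flow_rate_bound]
    show "Lp_norm T p norm (\<lambda>t. \<iota> (time_deriv (affine_interp \<tau> z) t)) \<le> ennreal C"
      unfolding NT using C(5) by (meson ennreal_leI order_trans)
  qed
qed

end
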